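(* Let $\mathcal H=\mathbb C_r^2\otimes\mathbb C_t^2$ (two qubits labelled $r$ and $t$), and for $\bm\theta=(\theta_1,\theta_2,\theta_3)^T\in\mathbb R^3$ let $\rho_{\bm\theta}=U_{\bm\theta}\,\rho_0\,U_{\bm\theta}^\dagger$, where $$\rho_0=|0\rangle\langle 0|_r\otimes\tfrac12\mathbb I_t,\qquad U_{\bm\theta}=\exp\!\Big[-\mathrm i\sqrt2\big(\theta_1\,\sigma_x^{(r)}\otimes\mathbb I_t+\theta_2\,\sigma_y^{(r)}\otimes\mathbb I_t+\theta_3\,\sigma_y^{(r)}\otimes\sigma_x^{(t)}\big)\Big].$$ This is a smooth family of states of constant rank two, locally identifiable at $\bm\theta=0$. For this model at the local point $\bm\theta=0$ with weight matrix $W=\mathbb I_3$, the normalized one-copy and two-copy optima $C^{(1)},C^{(2)}$ and the Holevo Cramér–Rao bound $C^{\mathrm H}$ satisfy $$C^{(1)}(\mathbb I_3)=\frac{3+2\sqrt2}{8}\;>\;C^{\mathrm H}(\mathbb I_3)=C^{(2)}(\mathbb I_3)=\frac58 ,$$ and the value $C^{(2)}(\mathbb I_3)=5/8$ is attained by a locally unbiased estimator based on a projective measurement on two copies. In particular, a strict gap between the one-copy optimum and the Holevo bound does not in general imply a strict gap at every finite copy number.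
   Context: $\sigma_x,\sigma_y,\sigma_z$ are the Pauli matrices; superscripts $(r),(t)$ indicate the tensor factor acted on; $\mathbb I$ is the identity. General setting. Let $\rho_{\bm\theta}$ be a smooth $p$-parameter family of density operators on a finite-dimensional Hilbert space $\mathcal H$, with $\bm\theta=0$ an interior point of the parameter set. Put $\rho=\rho_{\bm 0}$ and $D_\mu=\partial_{\theta_\mu}\rho_{\bm\theta}|_{\bm\theta=0}$. The model is locally identifiable (at $0$) if $D_1,\dots,D_p$ are linearly independent. For $n\ge1$ put $D_\mu^{(n)}=\partial_{\theta_\mu}\rho_{\bm\theta}^{\otimes n}|_{\bm\theta=0}$. Finite-copy optimum. An $n$-copy estimator is a POVM $\mathcal M=\{M_k\}$ on $\mathcal H^{\otimes n}$ (finitely many outcomes; $M_k\ge0$, $\sum_kM_k=\mathbb I$) together with vectors $\widetilde{\bm\theta}(k)\in\mathbb R^p$. It is locally unbiased if $\sum_k\operatorname{Tr}(\rho^{\otimes n}M_k)\,\widetilde\theta_\mu(k)=0$ and $\sum_k\operatorname{Tr}(D^{(n)}_\nu M_k)\,\widetilde\theta_\mu(k)=\delta_{\mu\nu}$ for all $\mu,\nu$. Its mean-square error matrix is $V=\sum_k\operatorname{Tr}(\rho^{\otimes n}M_k)\,\widetilde{\bm\theta}(k)\widetilde{\bm\theta}(k)^T$. For a real symmetric positive-definite $p\times p$ matrix $W$, the normalized finite-copy optimum is $$C^{(n)}(W)=n\min_{\mathcal M,\widetilde{\bm\theta}}\operatorname{Tr}(WV),$$ the minimum (understood as infimum) being over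 locally unbiased $n$-copy estimators. Holevo bound. $$C^{\mathrm H}(W)=\min_X\big\{\operatorname{Tr}[W\operatorname{Re}Z(X)]+\|\sqrt W\,\operatorname{Im}Z(X)\,\sqrt W\|_1\big\},$$ where $X=(X_1,\dots,X_p)$ ranges over tuples of Hermitian operators on $\mathcal H$ with $\operatorname{Tr}(\rho X_\mu)=0$ and $\operatorname{Tr}(D_\nu X_\mu)=\delta_{\mu\nu}$, $Z_{\mu\nu}(X)=\operatorname{Tr}(\rho X_\mu X_\nu)$, real and imaginary parts are entrywise, and $\|A\|_1=\operatorname{Tr}\sqrt{A^\dagger A}$. *)

theory Defs
  imports "HOL-Analysis.Analysis"
begin

section \<open>Operators on finite-dimensional Hilbert spaces\<close>

text \<open>
  The Hilbert space with orthonormal basis indexed by a finite type \<open>'h\<close> is \<open>complex^'h\<close>;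
  an operator on it is given by its matrix, of type \<open>complex^'h^'h\<close>. The tensor product of the
  spaces indexed by \<open>'a\<close> and \<open>'b\<close> is indexed by \<open>'a \<times> 'b\<close>. The \<open>n\<close>-fold tensor power of the
  space indexed by \<open>'h\<close> is indexed by \<open>'n \<Rightarrow> 'h\<close>, where \<open>'n\<close> is a finite type (the labels of
  the copies) with \<open>CARD('n) = n\<close>.
\<close>

type_synonym 'h operator = "complex^'h^'h"

definition dagger :: "complex^'a::finite^'b::finite \<Rightarrow> complex^'b^'a" where
  "dagger A = (\<chi> i j. cnj (A $ j $ i))"

definition hermitian :: "'h::finite operator \<Rightarrow> bool" where
  "hermitian A \<longleftrightarrow> dagger A = A"

definition psd :: "'h::finite operator \<Rightarrow> bool" where
  "psd A \<longleftrightarrow> hermitian A \<and> (\<forall>v. 0 \<le> Re (\<Sum>i\<in>UNIV. cnj (v $ i) * (A *v v) $ i))"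

definition density_operator :: "'h::finite operator \<Rightarrow> bool" where
  "density_operator A \<longleftrightarrow> psd A \<and> trace A = 1"

definition psd_sqrt :: "'h::finite operator \<Rightarrow> 'h operator" where
  "psd_sqrt A = (THE B. psd B \<and> B ** B = A)"

text \<open>The trace below is a nonnegative real number, so taking \<open>Re\<close> only changes its type.\<close>

definition trace_norm :: "'h::finite operator \<Rightarrow> real" where
  "trace_norm A = Re (trace (psd_sqrt (dagger A ** A)))"

definition smult_op :: "complex \<Rightarrow> 'h::finite operator \<Rightarrow> 'h operator" (infixr "\<cdot>\<^sub>C" 75) where
  "c \<cdot>\<^sub>C A = map_matrix ((*) c) A"

definition tensor_op :: "'a::finite operator \<Rightarrow> 'b::finite operator \<Rightarrow> ('a \<times> 'b) operator"
    (infixr "\<otimes>\<^sub>o" 72) where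
  "A \<otimes>\<^sub>o B = (\<chi> i j. A $ fst i $ fst j * B $ snd i $ snd j)"

definition tensor_power :: "'h::finite operator \<Rightarrow> ('n::finite \<Rightarrow> 'h) operator" where
  "tensor_power A = (\<chi> i j. \<Prod>k\<in>UNIV. A $ i k $ j k)"

definition op_power :: "'h::finite operator \<Rightarrow> nat \<Rightarrow> 'h operator" where
  "op_power A k = (((**) A) ^^ k) (mat 1)"

definition op_exp :: "'h::finite operator \<Rightarrow> 'h operator" where
  "op_exp A = (\<Sum>k. (1 / fact k) *\<^sub>R op_power A k)"


section \<open>Parametric models\<close>

primrec Ck_differentiable ::
    "nat \<Rightarrow> ('a::real_normed_vector \<Rightarrow> 'b::real_normed_vector) \<Rightarrow> bool" where
  "Ck_differentiable 0 f \<longleftrightarrow> continuous_on UNIV f"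
| "Ck_differentiable (Suc k) f \<longleftrightarrow>
     (\<forall>x. f differentiable at x) \<and>
     (\<forall>v. Ck_differentiable k (\<lambda>x. frechet_derivative f (at x) v))"

definition smooth :: "('a::real_normed_vector \<Rightarrow> 'b::real_normed_vector) \<Rightarrow> bool" where
  "smooth f \<longleftrightarrow> (\<forall>k. Ck_differentiable k f)"

definition smooth_state_family :: "(real^'p \<Rightarrow> 'h::finite operator) \<Rightarrow> bool" where
  "smooth_state_family \<rho> \<longleftrightarrow> smooth \<rho> \<and> (\<forall>\<theta>. density_operator (\<rho> \<theta>))"

text \<open>The partial derivative in direction \<open>\<mu>\<close> at the parameter value 0.\<close>

definition partial0 :: "(real^'p \<Rightarrow> 'h::finite operator) \<Rightarrow> 'p \<Rightarrow> 'h operator" where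
  "partial0 \<rho> \<mu> = vector_derivative (\<lambda>t. \<rho> (t *\<^sub>R axis \<mu> 1)) (at 0)"

definition locally_identifiable :: "(real^'p \<Rightarrow> 'h::finite operator) \<Rightarrow> bool" where
  "locally_identifiable \<rho> \<longleftrightarrow> inj (partial0 \<rho>) \<and> independent (range (partial0 \<rho>))"

definition pos_def :: "real^'p^'p \<Rightarrow> bool" where
  "pos_def W \<longleftrightarrow> transpose W = W \<and> (\<forall>x. x \<noteq> 0 \<longrightarrow> 0 < x \<bullet> (W *v x))"


section \<open>Finite-copy optimum\<close>

text \<open>
  An estimator has outcomes \<open>k < K\<close>, measurement operators \<open>M k\<close> and estimates \<open>est k\<close>. The
  definitions are given for an arbitrary family \<open>\<sigma>\<close>, to be used with
  \<open>\<sigma> = (\<lambda>\<theta>. tensor_power (\<rho> \<theta>))\<close>.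
\<close>

definition povm :: "nat \<Rightarrow> (nat \<Rightarrow> 'h::finite operator) \<Rightarrow> bool" where
  "povm K M \<longleftrightarrow> (\<forall>k<K. psd (M k)) \<and> (\<Sum>k<K. M k) = mat 1"

definition projective_measurement :: "nat \<Rightarrow> (nat \<Rightarrow> 'h::finite operator) \<Rightarrow> bool" where
  "projective_measurement K M \<longleftrightarrow>
     povm K M \<and> (\<forall>j<K. \<forall>k<K. M j ** M k = (if j = k then M j else 0))"

definition locally_unbiased ::
    "(real^'p \<Rightarrow> 'h::finite operator) \<Rightarrow> nat \<Rightarrow> (nat \<Rightarrow> 'h operator) \<Rightarrow> (nat \<Rightarrow> real^'p) \<Rightarrow> bool"
where
  "locally_unbiased \<sigma> K M est \<longleftrightarrow>
     povm K M \<and>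
     (\<forall>\<mu>. (\<Sum>k<K. trace (\<sigma> 0 ** M k) * of_real (est k $ \<mu>)) = 0) \<and>
     (\<forall>\<mu> \<nu>. (\<Sum>k<K. trace (partial0 \<sigma> \<nu> ** M k) * of_real (est k $ \<mu>)) =
        (if \<mu> = \<nu> then 1 else 0))"

text \<open>The outcome probabilities are real, so taking \<open>Re\<close> only changes their type.\<close>

definition mse_matrix ::
    "'h::finite operator \<Rightarrow> nat \<Rightarrow> (nat \<Rightarrow> 'h operator) \<Rightarrow> (nat \<Rightarrow> real^'p) \<Rightarrow> real^'p^'p" where
  "mse_matrix S K M est =
     (\<chi> \<mu> \<nu>. \<Sum>k<K. Re (trace (S ** M k)) * est k $ \<mu> * est k $ \<nu>)"

text \<open>
  The number of copies is \<open>CARD('n)\<close>. The infimum is taken in the extended reals, so that it is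
  \<open>\<infinity>\<close> in the absence of locally unbiased estimators.
\<close>

definition finite_copy_optimum ::
    "'n::finite itself \<Rightarrow> (real^'p \<Rightarrow> 'h::finite operator) \<Rightarrow> real^'p^'p \<Rightarrow> ereal" where
  "finite_copy_optimum _ \<rho> W =
     ereal (real CARD('n)) *
     Inf {ereal (trace (W ** mse_matrix (tensor_power (\<rho> 0)) K M est)) | K M est.
            locally_unbiased (\<lambda>\<theta>. tensor_power (\<rho> \<theta>) :: ('n \<Rightarrow> 'h) operator) K M est}"


section \<open>Holevo bound\<close>

definition holevo_feasible ::
    "(real^'p \<Rightarrow> 'h::finite operator) \<Rightarrow> ('p \<Rightarrow> 'h operator) \<Rightarrow> bool" where
  "holevo_feasible \<rho> X \<longleftrightarrow>
     (\<forall>\<mu>. hermitian (X \<mu>)) \<and>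
     (\<forall>\<mu>. trace (\<rho> 0 ** X \<mu>) = 0) \<and>
     (\<forall>\<mu> \<nu>. trace (partial0 \<rho> \<nu> ** X \<mu>) = (if \<mu> = \<nu> then 1 else 0))"

definition Z_matrix :: "'h::finite operator \<Rightarrow> ('p::finite \<Rightarrow> 'h operator) \<Rightarrow> complex^'p^'p" where
  "Z_matrix S X = (\<chi> \<mu> \<nu>. trace (S ** X \<mu> ** X \<nu>))"

definition holevo_value ::
    "(real^'p \<Rightarrow> 'h::finite operator) \<Rightarrow> real^'p^'p \<Rightarrow> ('p \<Rightarrow> 'h operator) \<Rightarrow> real" where
  "holevo_value \<rho> W X =
     (let Z = Z_matrix (\<rho> 0) X; sqrtW = psd_sqrt (map_matrix of_real W) in
      trace (W ** map_matrix Re Z) +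
      trace_norm (sqrtW ** map_matrix (\<lambda>z. of_real (Im z)) Z ** sqrtW))"

definition holevo_bound :: "(real^'p \<Rightarrow> 'h::finite operator) \<Rightarrow> real^'p^'p \<Rightarrow> ereal" where
  "holevo_bound \<rho> W = Inf {ereal (holevo_value \<rho> W X) | X. holevo_feasible \<rho> X}"


section \<open>The two-qubit model\<close>

text \<open>
  A qubit is indexed by the numeral type \<open>2\<close>; in the notation \<open>vector [a, b]\<close>, the computational
  basis vectors \<open>|0\<rangle>\<close> and \<open>|1\<rangle>\<close> are the first and the second one, in this order. The first
  tensor factor is the qubit \<open>r\<close>, the second one is the qubit \<open>t\<close>.
\<close>

definition sigma_x :: "2 operator" where
  "sigma_x = vector [vector [0, 1], vector [1, 0]]"

definition sigma_y :: "2 operator" where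
  "sigma_y = vector [vector [0, -\<i>], vector [\<i>, 0]]"

definition proj_ket0 :: "2 operator" where
  "proj_ket0 = vector [vector [1, 0], vector [0, 0]]"

definition qubit_rho0 :: "(2 \<times> 2) operator" where
  "qubit_rho0 = proj_ket0 \<otimes>\<^sub>o ((1 / 2) \<cdot>\<^sub>C mat 1)"

definition qubit_unitary :: "real^3 \<Rightarrow> (2 \<times> 2) operator" where
  "qubit_unitary \<theta> = op_exp ((- \<i> * of_real (sqrt 2)) \<cdot>\<^sub>C
     ((\<theta> $ 1) *\<^sub>R (sigma_x \<otimes>\<^sub>o mat 1) +
      (\<theta> $ 2) *\<^sub>R (sigma_y \<otimes>\<^sub>o mat 1) +
      (\<theta> $ 3) *\<^sub>R (sigma_y \<otimes>\<^sub>o sigma_x)))"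

definition qubit_model :: "real^3 \<Rightarrow> (2 \<times> 2) operator" where
  "qubit_model \<theta> = qubit_unitary \<theta> ** qubit_rho0 ** dagger (qubit_unitary \<theta>)"

end

theory Submission
  imports Defs
begin

text \<open>
  The lower bounds for finitely many copies come from weak duality: if \<open>\<parallel>e\<parallel>\<^sup>2 \<sigma> - \<Sum>\<^sub>\<mu> a\<^sub>\<mu> e\<^sub>\<mu> D\<^sub>\<mu> + Q \<ge> 0\<close> for all real vectors \<open>e\<close>, pairing with the
  measurement operators \<open>M\<^sub>k\<close> at \<open>e = est\<^sub>k\<close> and summing over \<open>k\<close> gives \<open>Tr V \<ge> \<Sum>\<^sub>\<mu> a\<^sub>\<mu> - Tr Q\<close>. For one and for two copies, the operator
  is an explicit sum of squares. The estimators attaining the bounds are read off from its kernels. In the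
  basis \<open>|\<plusminus>\<rangle>\<close> of the qubit \<open>t\<close>, the model splits into two pure qubit models in which \<open>\<theta>\<^sub>1\<close> and \<open>\<theta>\<^sub>2 \<plusminus> \<theta>\<^sub>3\<close> move
  \<open>|0\<rangle>\<close> along \<open>- \<i> |1\<rangle>\<close> and \<open>|1\<rangle>\<close>. With one copy, these two directions cannot be measured together. With two
  copies of opposite sign, \<open>\<theta>\<^sub>1\<close> is compatible with \<open>\<theta>\<^sub>3\<close>, which removes the trade-off.
\<close>

section \<open>Operators\<close>

text \<open>Smoothness is needed at every parameter value, where the noncommuting terms of the
  exponent obstruct a direct differentiation of the exponential. On each sign block of the qubit
  \<open>t\<close> the square of the exponent is scalar, so the exponential is built from entire
  functions of quadratic polynomials in \<theta>, and no square root has to be differentiated.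

  The value 5/8 is 1/2 + 1/8. For the Holevo functional, theta_1 and theta_2 share one direction up
  to a phase and cost 1/2 together; theta_3 costs 1/8. The two-copy dual point reproduces this
  split, halved, as 1/4 + 1/16. The scalars in both dual points maximise the concave quadratics that
  remain once the squares are completed. All three infima are attained by explicit points, so no
  compactness argument enters.\<close>

lemma dagger_nth [simp]: "dagger A $ i $ j = cnj (A $ j $ i)"
  by (simp add: dagger_def)

lemma dagger_dagger [simp]: "dagger (dagger A) = A"
  by (simp add: vec_eq_iff)

lemma dagger_matrix_mult: "dagger (A ** B) = dagger B ** dagger A"
  by (simp add: vec_eq_iff matrix_matrix_mult_def mult.commute)

lemma dagger_mat_1 [simp]: "dagger (mat 1) = mat 1"
  by (simp add: vec_eq_iff mat_def)

lemma dagger_add: "dagger (A + B) = dagger A + dagger B"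
  by (simp add: vec_eq_iff)

lemma dagger_diff: "dagger (A - B) = dagger A - dagger B"
  by (simp add: vec_eq_iff)

lemma dagger_scaleR: "dagger (c *\<^sub>R A) = c *\<^sub>R dagger A"
  by (simp add: vec_eq_iff)

lemma trace_dagger: "trace (dagger A) = cnj (trace A)"
  by (simp add: trace_def)

lemma trace_scaleR: "trace (c *\<^sub>R A) = c *\<^sub>R trace (A :: 'h::finite operator)"
  by (simp add: trace_def scaleR_sum_right)

lemma trace_sum: "trace (\<Sum>k\<in>K. A k) = (\<Sum>k\<in>K. trace (A k :: 'h::finite operator))"
  unfolding trace_def by (simp add: sum.swap[of _ UNIV])

lemma matrix_mult_nth: "(A ** B) $ i $ j = (\<Sum>k\<in>UNIV. A $ i $ k * B $ k $ j)"
  by (simp add: matrix_matrix_mult_def)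

lemma trace_matrix_mult: "trace (A ** B) = (\<Sum>i\<in>UNIV. \<Sum>j\<in>UNIV. A $ i $ j * B $ j $ i)"
  by (simp add: trace_def matrix_mult_nth)

lemma matrix_mult_diff_left: "(A - B) ** C = A ** C - B ** (C :: 'h::finite operator)"
  by (simp add: vec_eq_iff matrix_mult_nth algebra_simps sum_subtractf)

lemma matrix_mult_diff_right: "C ** (A - B) = C ** A - C ** (B :: 'h::finite operator)"
  by (simp add: vec_eq_iff matrix_mult_nth algebra_simps sum_subtractf)

lemma matrix_mult_add_left: "(A + B) ** C = A ** C + B ** (C :: 'h::finite operator)"
  by (simp add: vec_eq_iff matrix_mult_nth algebra_simps sum.distrib)

lemma matrix_mult_scaleR_left: "(c *\<^sub>R A) ** B = c *\<^sub>R (A ** (B :: 'h::finite operator))"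
  by (simp add: vec_eq_iff matrix_mult_nth scaleR_sum_right)

lemma matrix_mult_scaleR_right: "A ** (c *\<^sub>R B) = c *\<^sub>R (A ** (B :: 'h::finite operator))"
  by (simp add: vec_eq_iff matrix_mult_nth scaleR_sum_right)

lemma matrix_mult_zero_left [simp]: "0 ** A = (0 :: 'h::finite operator)"
  by (simp add: vec_eq_iff matrix_mult_nth)

lemma matrix_mult_zero_right [simp]: "A ** 0 = (0 :: 'h::finite operator)"
  by (simp add: vec_eq_iff matrix_mult_nth)

section \<open>Inner product and positive operators\<close>

definition cinner :: "complex^'h::finite \<Rightarrow> complex^'h \<Rightarrow> complex" where
  "cinner v w = (\<Sum>i\<in>UNIV. cnj (v $ i) * w $ i)"

lemma cinner_add_left: "cinner (u + v) w = cinner u w + cinner v w"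
  by (simp add: cinner_def algebra_simps sum.distrib)

lemma cinner_add_right: "cinner u (v + w) = cinner u v + cinner u w"
  by (simp add: cinner_def algebra_simps sum.distrib)

lemma cinner_scale_left: "cinner (c *s u) w = cnj c * cinner u w"
  by (simp add: cinner_def sum_distrib_left algebra_simps)

lemma cinner_scale_right: "cinner u (c *s w) = c * cinner u w"
  by (simp add: cinner_def sum_distrib_left algebra_simps)

lemma cinner_commute: "cinner v u = cnj (cinner u v)"
  by (simp add: cinner_def mult.commute)

lemma cinner_dagger: "cinner u (A *v w) = cinner (dagger A *v u) w"
  unfolding cinner_def matrix_vector_mult_def
  by (simp add: sum_distrib_left sum_distrib_right algebra_simps) (rule sum.swap)

lemma cinner_self: "cinner v v = of_real (\<Sum>i\<in>UNIV. (cmod (v $ i))\<^sup>2)"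
  by (simp add: cinner_def mult.commute flip: complex_norm_square)

lemma cinner_self_eq_0: "cinner v v = 0 \<longleftrightarrow> v = 0"
  unfolding cinner_self of_real_eq_0_iff
  by (simp add: sum_nonneg_eq_0_iff vec_eq_iff)

lemma matrix_vector_mult_axis: "(A :: 'h::finite operator) *v axis j 1 = column j A"
  by (simp add: vec_eq_iff matrix_vector_mult_def axis_def column_def if_distrib cong: if_cong)

lemma cinner_axis: "cinner (axis i 1) v = v $ i"
proof -
  have "cinner (axis i 1) v = (\<Sum>k\<in>UNIV. if k = i then v $ k else 0)"
    unfolding cinner_def by (intro sum.cong) (auto simp: axis_def)
  then show ?thesis
    by simp
qed

lemma psd_cinner: "psd A \<longleftrightarrow> hermitian A \<and> (\<forall>v. 0 \<le> Re (cinner v (A *v v)))"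
  by (simp add: psd_def cinner_def)

lemma psd_dagger_mult_self: "psd (dagger A ** A)"
  unfolding psd_cinner
proof (intro conjI allI)
  show "hermitian (dagger A ** A)"
    by (simp add: hermitian_def dagger_matrix_mult)
  fix v
  have "cinner v ((dagger A ** A) *v v) = cinner (A *v v) (A *v v)"
    using cinner_dagger[of v "dagger A" "A *v v"] by (simp add: matrix_vector_mul_assoc)
  also have "Re \<dots> \<ge> 0"
    by (simp add: cinner_self sum_nonneg)
  finally show "0 \<le> Re (cinner v ((dagger A ** A) *v v))" .
qed

lemma psd_conjugate:
  assumes "psd M"
  shows "psd (dagger A ** M ** A)"
  unfolding psd_cinner
proof (intro conjI allI)
  show "hermitian (dagger A ** M ** A)"
    using assms by (simp add: psd_def hermitian_def dagger_matrix_mult matrix_mul_assoc)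
  fix v
  have "cinner v ((dagger A ** M ** A) *v v) = cinner (A *v v) (M *v (A *v v))"
    using cinner_dagger[of v "dagger A" "M *v (A *v v)"] by (simp add: matrix_vector_mul_assoc matrix_mul_assoc)
  then show "0 \<le> Re (cinner v ((dagger A ** M ** A) *v v))"
    using assms by (simp add: psd_cinner)
qed

lemma psd_mat_1: "psd (mat 1)"
  using psd_dagger_mult_self[of "mat 1"] by simp

lemma psd_scaleR:
  assumes "psd A" "0 \<le> c"
  shows "psd (c *\<^sub>R A)"
proof -
  have "cinner v ((c *\<^sub>R A) *v v) = c *\<^sub>R cinner v (A *v v)" for v
    by (simp add: cinner_def matrix_vector_mult_def scaleR_sum_right sum_distrib_left algebra_simps)
  then show ?thesis
    using assms by (simp add: psd_cinner hermitian_def dagger_scaleR)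
qed

lemma psd_diag_nonneg:
  assumes "psd A"
  shows "0 \<le> Re (A $ i $ i)"
proof -
  have "0 \<le> Re (cinner (axis i 1) (A *v axis i 1))"
    using assms by (simp add: psd_cinner)
  then show ?thesis
    by (simp add: cinner_axis matrix_vector_mult_axis column_def)
qed

lemma psd_trace_nonneg: "psd A \<Longrightarrow> 0 \<le> Re (trace A)"
  by (simp add: trace_def sum_nonneg psd_diag_nonneg)

lemma cinner_psd_commute:
  "psd A \<Longrightarrow> cinner u (A *v w) = cnj (cinner w (A *v u))"
  by (metis cinner_commute cinner_dagger hermitian_def psd_def)

text \<open>If \<open>\<langle>v, A v\<rangle> = 0\<close>, then the minimum of \<open>s \<mapsto> \<langle>v + s A v, A (v + s A v)\<rangle>\<close> over the reals is
  attained at 0, so its derivative \<open>2 \<parallel>A v\<parallel>\<^sup>2\<close> there vanishes.\<close>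

lemma psd_kernel:
  assumes A: "psd A" and v: "Re (cinner v (A *v v)) = 0"
  shows "A *v v = 0"
proof -
  define w where "w = A *v v"
  define a b where "a = Re (cinner w w)" and "b = Re (cinner w (A *v w))"
  have *: "0 \<le> 2 * s * a + s\<^sup>2 * b" for s :: real
  proof -
    let ?x = "v + of_real s *s w"
    have "0 \<le> Re (cinner ?x (A *v ?x))"
      using A by (simp add: psd_cinner)
    also have "cinner ?x (A *v ?x) = cinner v (A *v v) + of_real s * cinner v (A *v w)
        + of_real s * cinner w w + of_real (s\<^sup>2) * cinner w (A *v w)"
      by (simp add: matrix_vector_right_distrib vector_scalar_commute cinner_add_left cinner_add_right
          cinner_scale_left cinner_scale_right w_def algebra_simps power2_eq_square)
    also have "cinner v (A *v w) = cnj (cinner w w)"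
      using cinner_psd_commute[OF A, of v w] by (simp add: w_def)
    finally show ?thesis
      using v by (simp add: a_def b_def)
  qed
  have "b \<ge> 0"
    using A by (simp add: b_def psd_cinner)
  \<comment> \<open>The denominator \<open>b + 1\<close> is positive even when \<open>b\<close> is
    0; the test value \<open>s = - t\<close> turns the bound into
    \<open>t\<^sup>2 * (b + 2) \<le> 0\<close>.\<close>
  define t where "t = a / (b + 1)"
  have a_eq: "a = t * (b + 1)"
    using \<open>b \<ge> 0\<close> by (simp add: t_def)
  have "t\<^sup>2 * (b + 2) \<le> 0"
    using *[of "- t"] by (simp add: a_eq algebra_simps power2_eq_square)
  then have "a = 0"
    using \<open>b \<ge> 0\<close> by (simp add: a_eq mult_le_0_iff)
  then have "cinner w w = 0"
    by (simp add: a_def cinner_self)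
  then show ?thesis
    by (simp add: cinner_self_eq_0 w_def)
qed

lemma dagger_mult_self_eq_0:
  assumes "dagger A ** A = 0"
  shows "A = 0"
proof -
  have "A *v v = 0" for v
  proof -
    have "cinner (A *v v) (A *v v) = cinner v ((dagger A ** A) *v v)"
      using cinner_dagger[of v "dagger A" "A *v v"] by (simp add: matrix_vector_mul_assoc)
    also have "\<dots> = 0"
      by (simp add: assms cinner_def)
    finally show ?thesis
      by (simp add: cinner_self_eq_0)
  qed
  then show ?thesis
    by (simp add: matrix_eq)
qed

lemma psd_trace_eq_0:
  assumes "psd A" "Re (trace A) = 0"
  shows "A = 0"
proof -
  have "Re (A $ i $ i) = 0" for i
  proof -
    have "\<forall>i. 0 \<le> Re (A $ i $ i)"
      using psd_diag_nonneg[OF assms(1)] by blast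
    then show ?thesis
      using assms(2) by (simp add: trace_def sum_nonneg_eq_0_iff)
  qed
  then have "A *v axis i 1 = 0" for i
    by (intro psd_kernel assms) (simp add: cinner_axis matrix_vector_mult_axis column_def)
  then have "column i A = 0" for i
    by (simp add: matrix_vector_mult_axis)
  then show ?thesis
    by (simp add: column_def vec_eq_iff)
qed

text \<open>For square roots \<open>B\<close>, \<open>C\<close> of the same operator, \<open>D = B - C\<close> anticommutes with \<open>B + C\<close>, hence
  \<open>D (B + C) D\<close> is psd with trace \<open>0\<close>.\<close>

lemma psd_sqrt_unique:
  assumes B: "psd B" and C: "psd C" and BC: "B ** B = C ** C"
  shows "B = C"
proof -
  define D where "D = B - C"
  have dD: "dagger D = D"
    using B C by (simp add: D_def dagger_diff psd_def hermitian_def)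
  have anti: "(B + C) ** D = - (D ** (B + C))"
    unfolding D_def by (simp add: matrix_mult_add_left matrix_add_ldistrib matrix_mult_diff_left
        matrix_mult_diff_right BC)
  have pB: "psd (dagger D ** B ** D)" and pC: "psd (dagger D ** C ** D)"
    using B C by (simp_all add: psd_conjugate)
  have "trace (D ** (B + C) ** D) = trace (D ** ((B + C) ** D))"
    by (simp add: matrix_mul_assoc)
  also have "\<dots> = trace (((B + C) ** D) ** D)"
    by (rule trace_mul_sym)
  also have "\<dots> = - trace (D ** (B + C) ** D)"
    by (simp add: anti trace_def matrix_mult_nth sum_negf)
  finally have "trace (D ** (B + C) ** D) = 0"
    by simp
  then have "trace (dagger D ** B ** D) + trace (dagger D ** C ** D) = 0"
    by (simp add: dD matrix_mult_add_left matrix_add_ldistrib trace_add)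
  then have "Re (trace (dagger D ** B ** D)) = 0" "Re (trace (dagger D ** C ** D)) = 0"
    using psd_trace_nonneg[OF pB] psd_trace_nonneg[OF pC]
    by (metis add_nonneg_eq_0_iff plus_complex.sel(1) zero_complex.sel(1))+
  then have z: "dagger D ** B ** D = 0" "dagger D ** C ** D = 0"
    using psd_trace_eq_0 pB pC by blast+
  have ker: "A ** D = 0" if "psd A" "dagger D ** A ** D = 0" for A
  proof -
    have "A *v (D *v v) = 0" for v
    proof (rule psd_kernel[OF that(1)])
      have "cinner (D *v v) (A *v (D *v v)) = cinner v ((dagger D ** A ** D) *v v)"
        using cinner_dagger[of v "dagger D" "A *v (D *v v)"] by (simp add: matrix_vector_mul_assoc matrix_mul_assoc)
      then show "Re (cinner (D *v v) (A *v (D *v v))) = 0"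
        by (simp add: that(2) cinner_def)
    qed
    then show ?thesis
      by (simp add: matrix_eq matrix_vector_mul_assoc)
  qed
  have "dagger D ** D = B ** D - C ** D"
    by (simp only: dD) (simp add: D_def matrix_mult_diff_left)
  also have "\<dots> = 0"
    using ker[OF B z(1)] ker[OF C z(2)] by simp
  finally show ?thesis
    using dagger_mult_self_eq_0[of D] by (simp add: D_def)
qed

lemma psd_sqrt_eqI: "psd B \<Longrightarrow> B ** B = A \<Longrightarrow> psd_sqrt A = B"
  unfolding psd_sqrt_def by (rule the_equality) (auto intro: psd_sqrt_unique)

lemma psd_sqrt_mat_1 [simp]: "psd_sqrt (mat 1) = mat 1"
  by (rule psd_sqrt_eqI) (simp_all add: psd_mat_1)

text \<open>\<open>A\<^sup>\<dagger> A\<close> has the eigenvalue \<open>0\<close> and the double eigenvalue \<open>r\<^sup>2\<close>, where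
  \<open>r\<^sup>2 = a\<^sup>2 + b\<^sup>2 + c\<^sup>2\<close> and \<open>a\<close>, \<open>b\<close>, \<open>c\<close> are the entries above the diagonal; hence its square root is \<open>A\<^sup>\<dagger> A / r\<close>.\<close>

lemma trace_norm_real_antisymmetric:
  fixes A :: "3 operator" and a b c :: real
  assumes A: "\<And>i. A $ i $ i = 0" "A $ 1 $ 2 = of_real a" "A $ 2 $ 1 = - of_real a"
    "A $ 1 $ 3 = of_real b" "A $ 3 $ 1 = - of_real b" "A $ 2 $ 3 = of_real c" "A $ 3 $ 2 = - of_real c"
  shows "trace_norm A = 2 * sqrt (a\<^sup>2 + b\<^sup>2 + c\<^sup>2)"
proof -
  define r where "r = sqrt (a\<^sup>2 + b\<^sup>2 + c\<^sup>2)"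
  have r2: "r\<^sup>2 = a\<^sup>2 + b\<^sup>2 + c\<^sup>2"
    by (simp add: r_def)
  have r2': "r * r = a * a + b * b + c * c"
    using r2 by (simp add: power2_eq_square)
  let ?Q = "dagger A ** A"
  have sq: "?Q ** ?Q = r\<^sup>2 *\<^sub>R ?Q"
    unfolding vec_eq_iff forall_3
    by (simp add: matrix_mult_nth sum_3 A r2' complex_eq_iff power2_eq_square algebra_simps)
  have tr: "trace ?Q = of_real (2 * r\<^sup>2)"
    by (simp add: trace_def matrix_mult_nth sum_3 A r2' complex_eq_iff power2_eq_square)
  have "psd_sqrt ?Q = inverse r *\<^sub>R ?Q"
  proof (rule psd_sqrt_eqI)
    show "psd (inverse r *\<^sub>R ?Q)"
      by (intro psd_scaleR psd_dagger_mult_self) (simp add: r_def)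
    show "(inverse r *\<^sub>R ?Q) ** (inverse r *\<^sub>R ?Q) = ?Q"
    \<comment> \<open>For \<open>r = 0\<close> the default \<open>inverse r = 0\<close> is still
      right: the trace \<open>2 * r\<^sup>2\<close> vanishes, and with it the positive operator
      itself.\<close>
    proof (cases "r = 0")
      case True
      then have "trace ?Q = 0"
        using tr by simp
      then have "?Q = 0"
        by (intro psd_trace_eq_0 psd_dagger_mult_self) simp
      then show ?thesis
        by simp
    next
      case False
      then show ?thesis
        by (simp add: matrix_mult_scaleR_left matrix_mult_scaleR_right sq power2_eq_square flip: mult.assoc)
    qed
  qed
  then have "trace_norm A = inverse r * (2 * r\<^sup>2)"
    by (simp add: trace_norm_def trace_scaleR tr)
  also have "\<dots> = 2 * r"
    by (cases "r = 0") (simp_all add: power2_eq_square)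
  finally show ?thesis
    by (simp add: r_def)
qed

section \<open>Smooth maps\<close>

text \<open>Derivatives are unique, so the choice made by \<open>frechet_derivative\<close> can be
  replaced by any explicit formula.\<close>

lemma Ck_differentiable_SucI:
  assumes "\<And>x. (f has_derivative f' x) (at x)" "\<And>v. Ck_differentiable k (\<lambda>x. f' x v)"
  shows "Ck_differentiable (Suc k) f"
proof -
  have "frechet_derivative f (at x) = f' x" for x
    using frechet_derivative_at[OF assms(1)] by simp
  then show ?thesis
    using assms by (auto simp: differentiable_def)
qed

lemma Ck_differentiable_Suc_has_derivative:
  "Ck_differentiable (Suc k) f \<Longrightarrow> (f has_derivative frechet_derivative f (at x)) (at x)"
  by (simp add: frechet_derivative_works[symmetric])

lemma Ck_differentiable_Suc_imp: "Ck_differentiable (Suc k) f \<Longrightarrow> Ck_differentiable k f"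
proof (induction k arbitrary: f)
  case 0
  then show ?case
    by (auto simp: differentiable_imp_continuous_within continuous_on_eq_continuous_within)
next
  case (Suc k)
  then show ?case
    by simp
qed

lemma Ck_differentiable_bounded_linear:
  assumes L: "bounded_linear L"
  shows "Ck_differentiable k f \<Longrightarrow> Ck_differentiable k (\<lambda>x. L (f x))"
proof (induction k arbitrary: f)
  case 0
  then show ?case
    using bounded_linear.continuous_on[OF L] by simp
next
  case (Suc k)
  show ?case
  proof (rule Ck_differentiable_SucI)
    show "((\<lambda>x. L (f x)) has_derivative (\<lambda>v. L (frechet_derivative f (at x) v))) (at x)" for x
      by (rule bounded_linear.has_derivative[OF L Ck_differentiable_Suc_has_derivative[OF Suc.prems]])
    show "Ck_differentiable k (\<lambda>x. L (frechet_derivative f (at x) v))" for v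
      using Suc by simp
  qed
qed

lemma Ck_differentiable_add:
  "Ck_differentiable k f \<Longrightarrow> Ck_differentiable k g \<Longrightarrow> Ck_differentiable k (\<lambda>x. f x + g x)"
proof (induction k arbitrary: f g)
  case 0
  then show ?case
    by (auto intro: continuous_on_add)
next
  case (Suc k)
  show ?case
  proof (rule Ck_differentiable_SucI)
    show "((\<lambda>x. f x + g x) has_derivative
        (\<lambda>v. frechet_derivative f (at x) v + frechet_derivative g (at x) v)) (at x)" for x
      by (intro has_derivative_add Ck_differentiable_Suc_has_derivative[OF Suc.prems(1)]
          Ck_differentiable_Suc_has_derivative[OF Suc.prems(2)])
    show "Ck_differentiable k (\<lambda>x. frechet_derivative f (at x) v + frechet_derivative g (at x) v)" for v
      using Suc by simp
  qed
qed

lemma Ck_differentiable_const: "Ck_differentiable k (\<lambda>x. c)"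
proof (induction k arbitrary: c)
  case (Suc k)
  show ?case
    by (rule Ck_differentiable_SucI[where f' = "\<lambda>_ _. 0"]) (auto simp: Suc)
qed simp

lemma Ck_differentiable_ident: "Ck_differentiable k (\<lambda>x. x)"
proof (cases k)
  case (Suc n)
  show ?thesis
    unfolding Suc by (rule Ck_differentiable_SucI[where f' = "\<lambda>_ v. v"]) (auto simp: Ck_differentiable_const)
qed simp

text \<open>By the product rule the derivative is a sum of two values of \<open>B\<close>. One
  factor of each is an undifferentiated function, whose regularity has to be lowered by one order
  before the induction hypothesis applies.\<close>

lemma Ck_differentiable_bilinear:
  assumes B: "bounded_bilinear B"
  shows "Ck_differentiable k f \<Longrightarrow> Ck_differentiable k g \<Longrightarrow> Ck_differentiable k (\<lambda>x. B (f x) (g x))"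
proof (induction k arbitrary: f g)
  case 0
  then show ?case
    using bounded_bilinear.continuous_on[OF B] by auto
next
  case (Suc k)
  show ?case
  proof (rule Ck_differentiable_SucI)
    show "((\<lambda>x. B (f x) (g x)) has_derivative
        (\<lambda>v. B (f x) (frechet_derivative g (at x) v) + B (frechet_derivative f (at x) v) (g x))) (at x)" for x
      by (intro bounded_bilinear.FDERIV[OF B] Ck_differentiable_Suc_has_derivative[OF Suc.prems(1)]
          Ck_differentiable_Suc_has_derivative[OF Suc.prems(2)])
    show "Ck_differentiable k (\<lambda>x. B (f x) (frechet_derivative g (at x) v)
        + B (frechet_derivative f (at x) v) (g x))" for v
      using Suc.prems by (intro Ck_differentiable_add Suc.IH) (auto intro: Ck_differentiable_Suc_imp)
  qed
qed

text \<open>Differentiation replaces the coefficients by \<open>diffs c\<close> and multiplies by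
  the derivative of \<open>f\<close>; hence the induction varies the coefficients.\<close>

lemma Ck_differentiable_power_series:
  fixes f :: "'a::real_normed_vector \<Rightarrow> real"
  shows "(\<And>y. summable (\<lambda>n. c n * y ^ n)) \<Longrightarrow> Ck_differentiable k f
    \<Longrightarrow> Ck_differentiable k (\<lambda>x. \<Sum>n. c n * f x ^ n)"
proof (induction k arbitrary: c)
  case 0
  have "continuous_on UNIV (\<lambda>y. \<Sum>n. c n * y ^ n)"
    using termdiffs_strong_converges_everywhere[OF 0(1)]
    by (meson DERIV_isCont continuous_at_imp_continuous_on)
  then show ?case
    using 0(2) continuous_on_compose2[of UNIV "\<lambda>y. \<Sum>n. c n * y ^ n" UNIV f] by simp
next
  case (Suc k)
  show ?case
  proof (rule Ck_differentiable_SucI)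
    show "((\<lambda>x. \<Sum>n. c n * f x ^ n) has_derivative
        (\<lambda>v. (\<Sum>n. diffs c n * f x ^ n) * frechet_derivative f (at x) v)) (at x)" for x
      using has_derivative_compose[OF Ck_differentiable_Suc_has_derivative[OF Suc.prems(2)]
          termdiffs_strong_converges_everywhere[OF Suc.prems(1), of "f x", unfolded has_field_derivative_def]] .
    show "Ck_differentiable k (\<lambda>x. (\<Sum>n. diffs c n * f x ^ n) * frechet_derivative f (at x) v)" for v
      using Suc.prems
      by (intro Ck_differentiable_bilinear[OF bounded_bilinear_mult] Suc.IH termdiff_converges_all)
        (auto intro: Ck_differentiable_Suc_imp)
  qed
qed

lemma smooth_const: "smooth (\<lambda>x. c)"
  by (simp add: smooth_def Ck_differentiable_const)

lemma smooth_bounded_linear: "bounded_linear L \<Longrightarrow> smooth f \<Longrightarrow> smooth (\<lambda>x. L (f x))"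
  by (simp add: smooth_def Ck_differentiable_bounded_linear)

lemma smooth_linear: "bounded_linear L \<Longrightarrow> smooth L"
  unfolding smooth_def using Ck_differentiable_bounded_linear[OF _ Ck_differentiable_ident] by blast

lemma smooth_add: "smooth f \<Longrightarrow> smooth g \<Longrightarrow> smooth (\<lambda>x. f x + g x)"
  by (simp add: smooth_def Ck_differentiable_add)

lemma smooth_bilinear:
  assumes "bounded_bilinear B" "smooth f" "smooth g"
  shows "smooth (\<lambda>x. B (f x) (g x))"
  unfolding smooth_def
proof
  fix k
  show "Ck_differentiable k (\<lambda>x. B (f x) (g x))"
    using assms(2,3) by (intro Ck_differentiable_bilinear[OF assms(1)]) (auto simp: smooth_def)
qed

lemmas smooth_mult = smooth_bilinear[OF bounded_bilinear_mult]
  and smooth_scaleR = smooth_bilinear[OF bounded_bilinear_scaleR]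

lemma smooth_power_series:
  fixes f :: "'a::real_normed_vector \<Rightarrow> real"
  shows "(\<And>y. summable (\<lambda>n. c n * y ^ n)) \<Longrightarrow> smooth f \<Longrightarrow> smooth (\<lambda>x. \<Sum>n. c n * f x ^ n)"
  by (simp add: smooth_def Ck_differentiable_power_series)

section \<open>The exponential of an operator whose square is scalar on two blocks\<close>

text \<open>\<open>cosq x = cos (sqrt x)\<close> and \<open>sincq x = sin (sqrt x) / sqrt x\<close> for \<open>x > 0\<close>, but as power series in \<open>x\<close>
  they are visibly smooth at 0.\<close>

definition cosq :: "real \<Rightarrow> real" where
  "cosq x = (\<Sum>n. (- 1) ^ n / fact (2 * n) * x ^ n)"

definition sincq :: "real \<Rightarrow> real" where
  "sincq x = (\<Sum>n. (- 1) ^ n / fact (2 * n + 1) * x ^ n)"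

lemma cosq_sums_square: "(\<lambda>n. (- 1) ^ n / fact (2 * n) * (y\<^sup>2) ^ n) sums cos y" for y :: real
  using cos_paired[of y] by (simp add: power_mult)

lemma sincq_sums_square:
  "y \<noteq> 0 \<Longrightarrow> (\<lambda>n. (- 1) ^ n / fact (2 * n + 1) * (y\<^sup>2) ^ n) sums (sin y / y)" for y :: real
  using sums_divide[OF sin_paired[of y], of y] by (simp add: power_mult)

text \<open>The cosine series converges at the radius \<open>\<bar>x\<bar> + 1\<close>, which lies
  strictly beyond \<open>x\<close>.\<close>

lemma cosq_summable: "summable (\<lambda>n. (- 1) ^ n / fact (2 * n) * (x::real) ^ n)"
  using cosq_sums_square[of "sqrt (\<bar>x\<bar> + 1)", THEN sums_summable]
  by (rule powser_inside) simp

lemma sincq_summable: "summable (\<lambda>n. (- 1) ^ n / fact (2 * n + 1) * (x::real) ^ n)"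
  using sincq_sums_square[of "sqrt (\<bar>x\<bar> + 1)", THEN sums_summable]
  by (rule powser_inside) auto

lemma cosq_square: "cosq (y\<^sup>2) = cos y"
  unfolding cosq_def by (rule sums_unique[symmetric, OF cosq_sums_square])

lemma sincq_square: "y * sincq (y\<^sup>2) = sin y"
proof (cases "y = 0")
  case False
  then show ?thesis
    unfolding sincq_def sums_unique[symmetric, OF sincq_sums_square[OF False]] by simp
qed simp

lemma cosq_0 [simp]: "cosq 0 = 1"
  using cosq_square[of 0] by simp

lemma sincq_0 [simp]: "sincq 0 = 1"
  unfolding sincq_def powser_zero by simp

lemma cosq_sincq_identity:
  assumes "0 \<le> x"
  shows "(cosq x)\<^sup>2 + x * (sincq x)\<^sup>2 = 1"
proof -
  define y where "y = sqrt x"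
  have "(cos y)\<^sup>2 + (sin y)\<^sup>2 = 1"
    by simp
  then show ?thesis
    using assms by (simp add: cosq_square[symmetric] sincq_square[symmetric] power_mult_distrib y_def)
qed

lemma smooth_cosq: "smooth f \<Longrightarrow> smooth (\<lambda>x. cosq (f x))"
  unfolding cosq_def by (rule smooth_power_series) (rule cosq_summable)

lemma smooth_sincq: "smooth f \<Longrightarrow> smooth (\<lambda>x. sincq (f x))"
  unfolding sincq_def by (rule smooth_power_series) (rule sincq_summable)

lemma has_field_derivative_cosq: "\<exists>D. (cosq has_real_derivative D) (at x)"
  unfolding cosq_def using termdiffs_strong_converges_everywhere[OF cosq_summable] by blast

lemma has_field_derivative_sincq: "\<exists>D. (sincq has_real_derivative D) (at x)"
  unfolding sincq_def using termdiffs_strong_converges_everywhere[OF sincq_summable] by blast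

lemma op_power_0 [simp]: "op_power A 0 = mat 1"
  and op_power_Suc: "op_power A (Suc k) = A ** op_power A k"
  by (simp_all add: op_power_def)

lemma op_power_block:
  fixes A P :: "'h::finite operator"
  assumes "A ** A ** P = (- x) *\<^sub>R P"
  shows "op_power A (2 * k) ** P = (- x) ^ k *\<^sub>R P"
    and "op_power A (2 * k + 1) ** P = (- x) ^ k *\<^sub>R (A ** P)"
proof -
  have mul_scaleR: "B ** (c *\<^sub>R C) = c *\<^sub>R (B ** C)" for B C :: "'h operator" and c :: real
    by (simp add: vec_eq_iff matrix_matrix_mult_def scaleR_sum_right)
  show even: "op_power A (2 * k) ** P = (- x) ^ k *\<^sub>R P" for k
  proof (induction k)
    case (Suc k)
    have "op_power A (2 * Suc k) ** P = A ** (A ** (op_power A (2 * k) ** P))"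
      by (simp add: op_power_Suc matrix_mul_assoc)
    also have "\<dots> = (- x) ^ k *\<^sub>R (A ** A ** P)"
      by (simp only: Suc mul_scaleR matrix_mul_assoc)
    finally show ?case
      by (simp add: assms)
  qed simp
  have "op_power A (2 * k + 1) ** P = A ** (op_power A (2 * k) ** P)"
    by (simp add: op_power_Suc matrix_mul_assoc)
  then show "op_power A (2 * k + 1) ** P = (- x) ^ k *\<^sub>R (A ** P)"
    by (simp only: even mul_scaleR)
qed

lemma op_exp_block_sums:
  fixes A P :: "'h::finite operator"
  assumes "A ** A ** P = (- x) *\<^sub>R P"
  shows "(\<lambda>k. (1 / fact k) *\<^sub>R (op_power A k ** P)) sums (cosq x *\<^sub>R P + sincq x *\<^sub>R (A ** P))"
proof -
  \<comment> \<open>The even and the odd terms of the exponential series, padded with zeros: their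
    sums are \<open>cosq x\<close> and \<open>sincq x\<close>.\<close>
  define a where "a k = (if even k then (- 1) ^ (k div 2) / fact (2 * (k div 2)) * x ^ (k div 2) else 0)" for k :: nat
  define b where "b k = (if even k then 0 else (- 1) ^ ((k - 1) div 2) / fact (2 * ((k - 1) div 2) + 1)
    * x ^ ((k - 1) div 2))" for k :: nat
  have "a sums cosq x"
    using sums_if[OF sums_zero summable_sums[OF cosq_summable[of x]]] unfolding a_def cosq_def by simp
  moreover have "b sums sincq x"
    using sums_if'[OF summable_sums[OF sincq_summable[of x]]] unfolding b_def sincq_def by simp
  ultimately have "(\<lambda>k. a k *\<^sub>R P + b k *\<^sub>R (A ** P)) sums (cosq x *\<^sub>R P + sincq x *\<^sub>R (A ** P))"
    by (intro sums_add sums_scaleR_left)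
  moreover have "a k *\<^sub>R P + b k *\<^sub>R (A ** P) = (1 / fact k) *\<^sub>R (op_power A k ** P)" for k
  proof (cases "even k")
    case True
    then obtain j where "k = 2 * j"
      by blast
    then show ?thesis
      using op_power_block(1)[OF assms, of j] by (simp add: a_def b_def power_minus[of x])
  next
    case False
    then obtain j where "k = 2 * j + 1"
      using oddE by blast
    then show ?thesis
      using op_power_block(2)[OF assms, of j] by (simp add: a_def b_def power_minus[of x])
  qed
  ultimately show ?thesis
    by simp
qed

lemma op_exp_two_blocks:
  fixes A P Q :: "'h::finite operator"
  assumes P: "A ** A ** P = (- x) *\<^sub>R P" and Q: "A ** A ** Q = (- y) *\<^sub>R Q" and PQ: "P + Q = mat 1"
  shows "op_exp A = (cosq x *\<^sub>R P + sincq x *\<^sub>R (A ** P)) + (cosq y *\<^sub>R Q + sincq y *\<^sub>R (A ** Q))"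
proof -
  have "op_power A k ** P + op_power A k ** Q = op_power A k" for k
    using PQ by (simp flip: matrix_add_ldistrib)
  then have "(\<lambda>k. (1 / fact k) *\<^sub>R op_power A k) sums
      ((cosq x *\<^sub>R P + sincq x *\<^sub>R (A ** P)) + (cosq y *\<^sub>R Q + sincq y *\<^sub>R (A ** Q)))"
    using sums_add[OF op_exp_block_sums[OF P] op_exp_block_sums[OF Q]]
    by (simp flip: scaleR_add_right)
  then show ?thesis
    unfolding op_exp_def by (rule sums_unique[symmetric])
qed

section \<open>The two-qubit model at all parameter values\<close>

lemma sum_qubit_pair: "(\<Sum>i\<in>UNIV. f i) = f (1, 1) + f (1, 2) + f (2, 1) + f (2, 2 :: 2)"
  for f :: "2 \<times> 2 \<Rightarrow> 'a::comm_monoid_add"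
proof -
  have "(\<Sum>i\<in>UNIV. f i) = (\<Sum>a\<in>UNIV. \<Sum>b\<in>UNIV. f (a, b))"
    by (simp add: sum.cartesian_product)
  then show ?thesis
    by (simp add: sum_2 add.assoc)
qed

lemmas qubit_entries = vec_eq_iff forall_2 split_paired_All matrix_mult_nth sum_qubit_pair

text \<open>The mixed terms vanish because \<open>A\<close> commutes with the orthogonal
  projections. On the block of \<open>P\<close>, \<open>A\<close> being anti-hermitian gives (c - s
  A)(c + s A) = c^2 - s^2 A^2 = c^2 + x s^2, and likewise for \<open>Q\<close>.\<close>

lemma block_unitary:
  fixes A P Q :: "'h::finite operator"
  assumes P: "A ** A ** P = (- x) *\<^sub>R P" "dagger P = P" "P ** P = P" "P ** A = A ** P"
    and Q: "A ** A ** Q = (- y) *\<^sub>R Q" "dagger Q = Q" "Q ** Q = Q" "Q ** A = A ** Q"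
    and PQ: "P ** Q = 0" "Q ** P = 0" "P + Q = mat 1" and A: "dagger A = - A"
    and c: "c\<^sup>2 + x * s\<^sup>2 = 1" "d\<^sup>2 + y * t\<^sup>2 = 1"
    and U: "U = (c *\<^sub>R P + s *\<^sub>R (A ** P)) + (d *\<^sub>R Q + t *\<^sub>R (A ** Q))"
  shows "dagger U ** U = mat 1"
proof -
  have neg: "- B ** C = - (B ** C)" "C ** - B = - (C ** B)" for B C :: "'h operator"
    by (simp_all add: vec_eq_iff matrix_mult_nth sum_negf)
  have dU: "dagger U = (c *\<^sub>R P - s *\<^sub>R (A ** P)) + (d *\<^sub>R Q - t *\<^sub>R (A ** Q))"
    by (simp add: U dagger_add dagger_scaleR dagger_matrix_mult P Q A neg)
  have left: "P ** (A ** B) = A ** (P ** B)" "Q ** (A ** B) = A ** (Q ** B)" "P ** (P ** B) = P ** B"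
    "Q ** (Q ** B) = Q ** B" "P ** (Q ** B) = 0" "Q ** (P ** B) = 0" for B
    by (simp_all add: matrix_mul_assoc P Q PQ)
  have AAP: "A ** (A ** P) = (- x) *\<^sub>R P" "A ** (A ** Q) = (- y) *\<^sub>R Q"
    using P(1) Q(1) by (simp_all add: matrix_mul_assoc)
  have "dagger U ** U = (c\<^sup>2 + x * s\<^sup>2) *\<^sub>R P + (d\<^sup>2 + y * t\<^sup>2) *\<^sub>R Q"
    unfolding dU unfolding U
    by (simp add: matrix_add_ldistrib matrix_mult_add_left matrix_mult_diff_left matrix_mult_scaleR_left
        matrix_mult_scaleR_right matrix_mul_assoc[symmetric] left AAP P(3,4) Q(3,4) PQ algebra_simps power2_eq_square)
  then show ?thesis
    using c PQ(3) by simp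
qed

definition generator :: "real^3 \<Rightarrow> (2 \<times> 2) operator" where
  "generator \<theta> = (- \<i> * of_real (sqrt 2)) \<cdot>\<^sub>C
     ((\<theta> $ 1) *\<^sub>R (sigma_x \<otimes>\<^sub>o mat 1) +
      (\<theta> $ 2) *\<^sub>R (sigma_y \<otimes>\<^sub>o mat 1) +
      (\<theta> $ 3) *\<^sub>R (sigma_y \<otimes>\<^sub>o sigma_x))"

text \<open>\<open>sign_proj (\<plusminus>1)\<close> projects the qubit \<open>t\<close> on \<open>|\<plusminus>\<rangle>\<close>, and \<open>generator \<theta>\<close> squares to
  \<open>- block_rate (\<plusminus>1) \<theta>\<close> on the range of that projection.\<close>

definition sign_proj :: "real \<Rightarrow> (2 \<times> 2) operator" where
  "sign_proj s = mat 1 \<otimes>\<^sub>o ((1 / 2) *\<^sub>R (mat 1 + s *\<^sub>R sigma_x))"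

definition block_rate :: "real \<Rightarrow> real^3 \<Rightarrow> real" where
  "block_rate s \<theta> = 2 * ((\<theta> $ 1)\<^sup>2 + (\<theta> $ 2 + s * \<theta> $ 3)\<^sup>2)"

lemmas pauli_defs = sigma_x_def sigma_y_def proj_ket0_def tensor_op_def smult_op_def map_matrix_def mat_def

lemma generator_nth:
  "generator \<theta> $ i $ j = (if fst i = fst j then 0 else - \<i> * of_real (sqrt 2) *
     (if snd i = snd j then of_real (\<theta> $ 1) + (if fst j = 1 then \<i> else - \<i>) * of_real (\<theta> $ 2)
      else (if fst j = 1 then \<i> else - \<i>) * of_real (\<theta> $ 3)))"
  (is "?P i j")
proof -
  have "\<forall>i j. ?P i j"
    unfolding split_paired_All forall_2
    by (simp add: generator_def pauli_defs complex_eq_iff algebra_simps)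
  then show ?thesis
    by blast
qed

lemma sign_proj_nth:
  "sign_proj s $ i $ j = (if fst i = fst j then of_real (if snd i = snd j then 1 / 2 else s / 2) else 0)"
  (is "?P i j")
proof -
  have "\<forall>i j. ?P i j"
    unfolding split_paired_All forall_2
    by (simp add: sign_proj_def pauli_defs complex_eq_iff)
  then show ?thesis
    by blast
qed

lemma generator_square_nth:
  "(generator \<theta> ** generator \<theta>) $ i $ j = (if fst i = fst j then of_real
     (if snd i = snd j then - 2 * ((\<theta> $ 1)\<^sup>2 + (\<theta> $ 2)\<^sup>2 + (\<theta> $ 3)\<^sup>2) else - 4 * \<theta> $ 2 * \<theta> $ 3) else 0)"
  (is "?P i j")
proof -
  have 2: "sqrt 2 * (sqrt 2 * x) = 2 * x" for x
    by (simp flip: mult.assoc)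
  have "\<forall>i j. ?P i j"
    unfolding split_paired_All forall_2
    by (simp add: matrix_mult_nth sum_qubit_pair generator_nth complex_eq_iff algebra_simps power2_eq_square 2)
  then show ?thesis
    by blast
qed

text \<open>On this block \<open>sigma_x\<close> of the qubit \<open>t\<close> acts as the number
  \<open>s\<close>, so the generator is - i sqrt 2 times theta_1 sigma_x + (theta_2 + s theta_3)
  sigma_y on the qubit \<open>r\<close>; the two Pauli matrices anticommute, which makes the square
  scalar.\<close>

lemma generator_square_block:
  assumes "s\<^sup>2 = 1"
  shows "generator \<theta> ** generator \<theta> ** sign_proj s = (- block_rate s \<theta>) *\<^sub>R sign_proj s"
proof -
  have s2: "s * s = 1" "s * (s * x) = x" for x
    using assms by (simp_all add: power2_eq_square flip: mult.assoc)
  show ?thesis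
    unfolding vec_eq_iff split_paired_All forall_2
    by (simp add: matrix_mult_nth[of "_ ** _"] sum_qubit_pair generator_square_nth sign_proj_nth block_rate_def
        complex_eq_iff algebra_simps power2_eq_square s2)
qed

lemma dagger_generator: "dagger (generator \<theta>) = - generator \<theta>"
  unfolding vec_eq_iff split_paired_All forall_2 by (simp add: generator_nth)

lemma sign_proj_generator: "sign_proj s ** generator \<theta> = generator \<theta> ** sign_proj s"
  unfolding vec_eq_iff split_paired_All forall_2
  by (simp add: matrix_mult_nth sum_qubit_pair generator_nth sign_proj_nth)

lemma sign_proj_simps:
  "dagger (sign_proj s) = sign_proj s"
  "sign_proj 1 ** sign_proj 1 = sign_proj 1" "sign_proj (-1) ** sign_proj (-1) = sign_proj (-1)"
  "sign_proj 1 ** sign_proj (-1) = 0" "sign_proj (-1) ** sign_proj 1 = 0"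
  "sign_proj 1 + sign_proj (-1) = mat 1"
  unfolding vec_eq_iff split_paired_All forall_2
  by (simp_all add: matrix_mult_nth sum_qubit_pair sign_proj_nth mat_def)

lemma qubit_unitary_eq:
  "qubit_unitary \<theta> =
    (cosq (block_rate 1 \<theta>) *\<^sub>R sign_proj 1 + sincq (block_rate 1 \<theta>) *\<^sub>R (generator \<theta> ** sign_proj 1)) +
    (cosq (block_rate (-1) \<theta>) *\<^sub>R sign_proj (-1)
      + sincq (block_rate (-1) \<theta>) *\<^sub>R (generator \<theta> ** sign_proj (-1)))"
  unfolding qubit_unitary_def generator_def[symmetric]
  by (intro op_exp_two_blocks generator_square_block sign_proj_simps) simp_all

lemma qubit_unitary_dagger_mult: "dagger (qubit_unitary \<theta>) ** qubit_unitary \<theta> = mat 1"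
  by (rule block_unitary[OF generator_square_block _ _ sign_proj_generator
        generator_square_block _ _ sign_proj_generator _ _ _ dagger_generator _ _ qubit_unitary_eq])
    (simp_all add: sign_proj_simps cosq_sincq_identity block_rate_def)

lemma linear_generator: "linear generator"
  by (simp add: linear_iff generator_def pauli_defs qubit_entries algebra_simps)

lemma bounded_linear_operator_nth: "bounded_linear (\<lambda>A :: 'h::finite operator. A $ i $ j)"
  using bounded_linear_compose[OF bounded_linear_vec_nth bounded_linear_vec_nth] .

lemma smooth_block_rate: "smooth (block_rate s)"
proof -
  have nth: "smooth (\<lambda>\<theta> :: real^3. \<theta> $ i)" for i
    by (rule smooth_linear) (rule bounded_linear_vec_nth)
  have 2: "smooth (\<lambda>\<theta> :: real^3. \<theta> $ 2 + s * \<theta> $ 3)"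
    using smooth_add[OF nth smooth_mult[OF smooth_const nth]] .
  show ?thesis
    unfolding block_rate_def power2_eq_square
    using smooth_mult[OF smooth_const smooth_add[OF smooth_mult[OF nth nth] smooth_mult[OF 2 2]]] .
qed

lemma smooth_scaleR_const:
  fixes f :: "'a::real_normed_vector \<Rightarrow> real"
  shows "smooth f \<Longrightarrow> smooth (\<lambda>x. f x *\<^sub>R c)"
  by (rule smooth_bounded_linear[OF bounded_linear_scaleR_left])

lemma bounded_bilinear_matrix_mult:
  "bounded_bilinear ((**) :: 'h::finite operator \<Rightarrow> 'h operator \<Rightarrow> 'h operator)"
  unfolding bilinear_conv_bounded_bilinear[symmetric] bilinear_def
  by (auto simp: linear_iff matrix_add_ldistrib matrix_mult_add_left matrix_mult_scaleR_left matrix_mult_scaleR_right)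

lemma bounded_linear_dagger: "bounded_linear (dagger :: 'h::finite operator \<Rightarrow> 'h operator)"
  by (simp add: linear_linear linear_iff dagger_add dagger_scaleR)

lemmas smooth_matrix_mult = smooth_bilinear[OF bounded_bilinear_matrix_mult]

lemma smooth_qubit_unitary: "smooth qubit_unitary"
proof -
  have block: "smooth (\<lambda>\<theta>. cosq (block_rate s \<theta>) *\<^sub>R sign_proj s
      + sincq (block_rate s \<theta>) *\<^sub>R (generator \<theta> ** sign_proj s))" for s
    using smooth_add[OF smooth_scaleR_const[OF smooth_cosq[OF smooth_block_rate]]
        smooth_scaleR[OF smooth_sincq[OF smooth_block_rate]
          smooth_matrix_mult[OF smooth_linear[OF linear_generator[unfolded linear_conv_bounded_linear]] smooth_const]]] .
  show ?thesis
    unfolding qubit_unitary_eq[abs_def] by (rule smooth_add[OF block block])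
qed

lemma smooth_qubit_model: "smooth qubit_model"
  unfolding qubit_model_def[abs_def]
  using smooth_matrix_mult[OF smooth_matrix_mult[OF smooth_qubit_unitary smooth_const]
      smooth_bounded_linear[OF bounded_linear_dagger smooth_qubit_unitary]] .

lemma qubit_rho0_nth:
  "qubit_rho0 $ i $ j = (if i = j \<and> fst i = 1 then 1 / 2 else 0)"
  (is "?P i j")
proof -
  have "\<forall>i j. ?P i j"
    unfolding split_paired_All forall_2
    by (simp add: qubit_rho0_def pauli_defs)
  then show ?thesis
    by blast
qed

lemma density_operator_qubit_rho0: "density_operator qubit_rho0"
proof -
  define R :: "(2 \<times> 2) operator" where "R = (\<chi> i j. if i = j \<and> fst i = 1 then of_real (1 / sqrt 2) else 0)"
  have "qubit_rho0 = dagger R ** R"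
    by (simp add: R_def qubit_rho0_nth qubit_entries complex_eq_iff)
  then show ?thesis
    using psd_dagger_mult_self[of R] by (simp add: density_operator_def trace_def sum_qubit_pair qubit_rho0_nth)
qed

lemma density_operator_qubit_model: "density_operator (qubit_model \<theta>)"
proof -
  let ?U = "qubit_unitary \<theta>"
  have "trace (qubit_model \<theta>) = trace (dagger ?U ** (?U ** qubit_rho0))"
    unfolding qubit_model_def by (rule trace_mul_sym)
  also have "\<dots> = 1"
    using density_operator_qubit_rho0
    by (simp add: matrix_mul_assoc qubit_unitary_dagger_mult density_operator_def)
  finally show ?thesis
    using psd_conjugate[of qubit_rho0 "dagger ?U"] density_operator_qubit_rho0
    by (simp add: density_operator_def qubit_model_def)
qed

section \<open>Constant rank\<close>

lemma rank_mult_le_left: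
  fixes A :: "'a::field^'n^'m"
  shows "rank (B ** A) \<le> rank A"
proof -
  have "row i (B ** A) = (\<Sum>k\<in>UNIV. B $ i $ k *s row k A)" for i
    by (simp add: row_def vec_eq_iff matrix_matrix_mult_def)
  moreover have "(\<Sum>k\<in>UNIV. B $ i $ k *s row k A) \<in> vec.span (rows A)" for i
    by (intro vec.span_sum vec.span_scale vec.span_base) (auto simp: rows_def)
  ultimately have "rows (B ** A) \<subseteq> vec.span (rows A)"
    by (auto simp: rows_def)
  then show ?thesis
    unfolding row_rank_def_gen by (rule vec.dim_mono)
qed

lemma rank_mult_le_right:
  fixes A :: "'a::field^'n^'m"
  shows "rank (A ** B) \<le> rank A"
proof -
  have "row i (A ** B) = transpose B *v row i A" for i
    by (simp add: row_def vec_eq_iff matrix_matrix_mult_def matrix_vector_mult_def transpose_def mult.commute)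
  then have "rows (A ** B) = (*v) (transpose B) ` rows A"
    by (auto simp: rows_def)
  then show ?thesis
    unfolding row_rank_def_gen using vec.dim_image_le[OF matrix_vector_mul_linear_gen] by metis
qed

lemma rank_qubit_rho0: "rank qubit_rho0 = 2"
proof -
  let ?B = "{axis (1, 1) (1 / 2), axis (1, 2) (1 / 2)} :: (complex^(2 \<times> 2)) set"
  have ne: "axis (1, 1) (1 / 2) \<noteq> (axis (1, 2) (1 / 2) :: complex^(2 \<times> 2))"
    by (simp add: axis_eq_axis)
  have row: "row i qubit_rho0 = (if fst i = 1 then axis i (1 / 2) else 0)" for i
    by (auto simp: row_def vec_eq_iff qubit_rho0_nth axis_def)
  have "rows qubit_rho0 = insert 0 ?B"
  proof -
    have "rows qubit_rho0 = (\<lambda>i. row i qubit_rho0) ` (UNIV \<times> UNIV)"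
      by (auto simp: rows_def)
    then show ?thesis
      by (simp add: row UNIV_2 Times_insert_left insert_commute)
  qed
  moreover have "axis (1, 1) (1 / 2) \<noteq> k *s (axis (1, 2) (1 / 2) :: complex^(2 \<times> 2))" for k
  proof
    assume "axis (1, 1) (1 / 2) = k *s (axis (1, 2) (1 / 2) :: complex^(2 \<times> 2))"
    from arg_cong[OF this, of "\<lambda>v. v $ (1, 1)"] show False
      by (simp add: axis_def)
  qed
  then have "vec.independent ?B"
    by (intro vec.independent_insertI) (auto simp: vec.dependent_single vec.span_singleton axis_eq_0_iff vec.independent_empty)
  ultimately show ?thesis
    unfolding row_rank_def_gen
    using ne vec.dim_eq_card_independent[of ?B] vec.dim_span[of "insert 0 ?B"] vec.dim_span[of ?B]
    by (simp add: vec.span_insert_0)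
qed

text \<open>Conjugation with the unitary is undone by its adjoint, so neither direction can raise
  the rank.\<close>

lemma rank_qubit_model: "rank (qubit_model \<theta>) = 2"
proof -
  let ?U = "qubit_unitary \<theta>"
  have "dagger ?U ** (qubit_model \<theta> ** ?U) = (dagger ?U ** ?U) ** qubit_rho0 ** (dagger ?U ** ?U)"
    by (simp add: qubit_model_def matrix_mul_assoc)
  then have "qubit_rho0 = dagger ?U ** (qubit_model \<theta> ** ?U)"
    by (simp add: qubit_unitary_dagger_mult)
  then have "rank qubit_rho0 \<le> rank (qubit_model \<theta>)"
    using order_trans[OF rank_mult_le_left rank_mult_le_right, of "dagger ?U" "qubit_model \<theta>" ?U] by simp
  moreover have "rank (qubit_model \<theta>) \<le> rank qubit_rho0"
    unfolding qubit_model_def by (rule order_trans[OF rank_mult_le_right rank_mult_le_left])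
  ultimately show ?thesis
    by (simp add: rank_qubit_rho0)
qed

section \<open>Derivatives at 0\<close>

text \<open>The derivatives of the model at 0 in closed form: commutators of the three terms of the
  exponent with the initial state (1 + sigma_z) / 4 of the qubit \<open>r\<close>, tensored with the
  identity.\<close>

definition tangent :: "3 \<Rightarrow> (2 \<times> 2) operator" where
  "tangent \<mu> = (sqrt 2 / 2) *\<^sub>R (if \<mu> = 1 then - (sigma_y \<otimes>\<^sub>o mat 1)
     else if \<mu> = 2 then sigma_x \<otimes>\<^sub>o mat 1 else sigma_x \<otimes>\<^sub>o sigma_x)"

lemma qubit_unitary_0 [simp]: "qubit_unitary 0 = mat 1"
  using linear_0[OF linear_generator] by (simp add: qubit_unitary_eq block_rate_def sign_proj_simps)

lemma qubit_model_0: "qubit_model 0 = qubit_rho0"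
  by (simp add: qubit_model_def)

text \<open>Along the line through \<open>v\<close> both block rates are multiples of t^2. Hence the
  \<open>cosq\<close> coefficients are stationary at 0, the coefficients \<open>t * sincq\<close>
  have derivative 1, and the blocks add up to the generator.\<close>

lemma has_vector_derivative_qubit_unitary:
  "((\<lambda>t. qubit_unitary (t *\<^sub>R v)) has_vector_derivative generator v) (at 0)"
proof -
  have rate: "block_rate s (t *\<^sub>R v) = block_rate s v * t\<^sup>2" for s t
    by (simp add: block_rate_def power2_eq_square algebra_simps)
  have gen: "sincq x *\<^sub>R (generator (t *\<^sub>R v) ** P) = (t * sincq x) *\<^sub>R (generator v ** P)"
    for x t and P :: "(2 \<times> 2) operator"
    by (simp add: linear_scale[OF linear_generator] matrix_mult_scaleR_left mult.commute)
  have quad: "((\<lambda>t. c * t\<^sup>2) has_real_derivative 0) (at 0)" for c :: real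
    by (auto intro!: derivative_eq_intros)
  have 1: "((\<lambda>t. cosq (c * t\<^sup>2)) has_real_derivative 0) (at 0)" for c
  proof -
    obtain D where "(cosq has_real_derivative D) (at (c * 0\<^sup>2))"
      using has_field_derivative_cosq by blast
    from DERIV_chain2[OF this quad] show ?thesis
      by simp
  qed
  have 2: "((\<lambda>t. t * sincq (c * t\<^sup>2)) has_real_derivative 1) (at 0)" for c
  proof -
    obtain D where "(sincq has_real_derivative D) (at (c * 0\<^sup>2))"
      using has_field_derivative_sincq by blast
    from DERIV_mult[OF DERIV_ident DERIV_chain2[OF this quad]] show ?thesis
      by simp
  qed
  have block: "((\<lambda>t. cosq (c * t\<^sup>2) *\<^sub>R P + (t * sincq (c * t\<^sup>2)) *\<^sub>R Q) has_vector_derivative Q) (at 0)"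
    for c and P Q :: "(2 \<times> 2) operator"
    using has_vector_derivative_add[OF has_vector_derivative_scaleR[OF 1 has_vector_derivative_const, of c P]
        has_vector_derivative_scaleR[OF 2 has_vector_derivative_const, of c Q]] by simp
  have sum: "generator v ** sign_proj 1 + generator v ** sign_proj (-1) = generator v"
    by (simp add: sign_proj_simps flip: matrix_add_ldistrib)
  show ?thesis
    unfolding qubit_unitary_eq rate gen
    using has_vector_derivative_add[OF block[where Q = "generator v ** sign_proj 1"]
        block[where Q = "generator v ** sign_proj (-1)"]] unfolding sum .
qed

lemma tangent_nth:
  "tangent \<mu> $ i $ j = (if fst i = fst j then 0 else of_real (sqrt 2 / 2) *
     (if \<mu> = 1 then if snd i = snd j then if fst j = 1 then - \<i> else \<i> else 0
      else if \<mu> = 2 then if snd i = snd j then 1 else 0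
      else if snd i = snd j then 0 else 1))"
  (is "?P i j")
proof -
  have "\<forall>i j. ?P i j"
    unfolding split_paired_All forall_2
    by (simp add: tangent_def pauli_defs complex_eq_iff)
  then show ?thesis
    by blast
qed

lemma generator_axis:
  "generator (axis \<mu> 1) ** qubit_rho0 - qubit_rho0 ** generator (axis \<mu> 1) = tangent \<mu>"
proof -
  have "\<mu> = 1 \<or> \<mu> = 2 \<or> \<mu> = 3"
    by (rule exhaust_3)
  then show ?thesis
    unfolding vec_eq_iff split_paired_All forall_2
    by (elim disjE) (simp_all add: matrix_mult_nth sum_qubit_pair tangent_nth generator_nth qubit_rho0_nth
        axis_def complex_eq_iff)
qed

lemma has_vector_derivative_qubit_model:
  "((\<lambda>t. qubit_model (t *\<^sub>R axis \<mu> 1)) has_vector_derivative tangent \<mu>) (at 0)"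
proof -
  let ?U = "\<lambda>t. qubit_unitary (t *\<^sub>R axis \<mu> 1)" and ?G = "generator (axis \<mu> 1)"
  note U = has_vector_derivative_qubit_unitary[of "axis \<mu> 1"]
  have "((\<lambda>t. ?U t ** qubit_rho0) has_vector_derivative ?G ** qubit_rho0) (at 0)"
    using bounded_linear.has_vector_derivative[OF bounded_bilinear.bounded_linear_left
        [OF bounded_bilinear_matrix_mult] U] .
  from bounded_bilinear.has_vector_derivative[OF bounded_bilinear_matrix_mult this
      bounded_linear.has_vector_derivative[OF bounded_linear_dagger U]]
  have "((\<lambda>t. qubit_model (t *\<^sub>R axis \<mu> 1)) has_vector_derivative
      qubit_rho0 ** dagger ?G + ?G ** qubit_rho0) (at 0)"
    by (simp add: qubit_model_def)
  moreover have "qubit_rho0 ** - ?G = - (qubit_rho0 ** ?G)"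
    by (simp add: vec_eq_iff matrix_mult_nth sum_negf)
  ultimately show ?thesis
    using generator_axis[of \<mu>] by (simp add: dagger_generator)
qed

lemma partial0_qubit_model: "partial0 qubit_model \<mu> = tangent \<mu>"
  unfolding partial0_def by (rule vector_derivative_at) (rule has_vector_derivative_qubit_model)

definition unit_op :: "'h \<Rightarrow> 'h \<Rightarrow> complex \<Rightarrow> 'h::finite operator" where
  "unit_op i j z = (\<chi> k l. if k = i \<and> l = j then z else 0)"

lemma bounded_linear_unit_op: "bounded_linear (unit_op i j)"
  unfolding linear_conv_bounded_linear[symmetric] by (auto simp: linear_iff unit_op_def vec_eq_iff)

lemma sum_unit_op: "(\<Sum>i\<in>UNIV. \<Sum>j\<in>UNIV. unit_op i j (A $ i $ j)) = A"
proof -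
  have "(\<Sum>i\<in>UNIV. \<Sum>j\<in>UNIV. unit_op i j (A $ i $ j)) $ k $ l = A $ k $ l" for k l
  proof -
    have "(\<Sum>i\<in>UNIV. \<Sum>j\<in>UNIV. unit_op i j (A $ i $ j)) $ k $ l
        = (\<Sum>i\<in>UNIV. \<Sum>j\<in>UNIV. if k = i \<and> l = j then A $ i $ j else 0)"
      by (simp add: unit_op_def)
    also have "\<dots> = (\<Sum>i\<in>UNIV. if k = i then \<Sum>j\<in>UNIV. if l = j then A $ i $ j else 0 else 0)"
      by (intro sum.cong) auto
    finally show ?thesis
      by simp
  qed
  then show ?thesis
    by (simp add: vec_eq_iff)
qed

text \<open>An operator is a finite sum of bounded linear images of its entries, so entrywise
  derivatives suffice.\<close>

lemma has_vector_derivative_operatorI: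
  fixes f :: "real \<Rightarrow> 'h::finite operator"
  assumes "\<And>i j. ((\<lambda>t. f t $ i $ j) has_vector_derivative D $ i $ j) F"
  shows "(f has_vector_derivative D) F"
proof -
  have "((\<lambda>t. \<Sum>i\<in>UNIV. \<Sum>j\<in>UNIV. unit_op i j (f t $ i $ j)) has_vector_derivative
      (\<Sum>i\<in>UNIV. \<Sum>j\<in>UNIV. unit_op i j (D $ i $ j))) F"
    by (intro has_vector_derivative_sum)
      (rule bounded_linear.has_vector_derivative[OF bounded_linear_unit_op assms])
  then show ?thesis
    by (simp add: sum_unit_op)
qed

section \<open>Derivatives of tensor powers\<close>

lemma tensor_power_1: "tensor_power A $ i $ j = A $ i 1 $ j 1"
  for A :: "'h::finite operator" and i :: "1 \<Rightarrow> 'h"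
  by (simp add: tensor_power_def)

lemma tensor_power_2: "tensor_power A $ i $ j = A $ i 1 $ j 1 * A $ i 2 $ j 2"
  for A :: "'h::finite operator" and i :: "2 \<Rightarrow> 'h"
  by (simp add: tensor_power_def UNIV_2)

lemma partial0_tensor_power_1:
  assumes "((\<lambda>t. \<rho> (t *\<^sub>R axis \<mu> 1)) has_vector_derivative D) (at 0)"
  shows "partial0 (\<lambda>\<theta>. tensor_power (\<rho> \<theta>) :: (1 \<Rightarrow> 'h::finite) operator) \<mu> = tensor_power D"
  unfolding partial0_def
proof (intro vector_derivative_at has_vector_derivative_operatorI)
  fix i j :: "1 \<Rightarrow> 'h"
  show "((\<lambda>t. tensor_power (\<rho> (t *\<^sub>R axis \<mu> 1)) $ i $ j) has_vector_derivative tensor_power D $ i $ j) (at 0)"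
    unfolding tensor_power_1
    using bounded_linear.has_vector_derivative[OF bounded_linear_operator_nth assms] .
qed

lemma partial0_tensor_power_2:
  assumes "((\<lambda>t. \<rho> (t *\<^sub>R axis \<mu> 1)) has_vector_derivative D) (at 0)"
  shows "partial0 (\<lambda>\<theta>. tensor_power (\<rho> \<theta>) :: (2 \<Rightarrow> 'h::finite) operator) \<mu> =
    (\<chi> i j. \<rho> 0 $ i 1 $ j 1 * D $ i 2 $ j 2 + D $ i 1 $ j 1 * \<rho> 0 $ i 2 $ j 2)"
  unfolding partial0_def
proof (intro vector_derivative_at has_vector_derivative_operatorI)
  fix i j :: "2 \<Rightarrow> 'h"
  show "((\<lambda>t. tensor_power (\<rho> (t *\<^sub>R axis \<mu> 1)) $ i $ j) has_vector_derivative
    (\<chi> i j. \<rho> 0 $ i 1 $ j 1 * D $ i 2 $ j 2 + D $ i 1 $ j 1 * \<rho> 0 $ i 2 $ j 2) $ i $ j) (at 0)"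
    unfolding tensor_power_2
    using has_vector_derivative_mult[OF bounded_linear.has_vector_derivative[OF bounded_linear_operator_nth assms]
        bounded_linear.has_vector_derivative[OF bounded_linear_operator_nth assms]] by simp
qed

section \<open>Estimators\<close>

definition outer :: "complex^'h::finite \<Rightarrow> 'h operator" where
  "outer v = (\<chi> i j. v $ i * cnj (v $ j))"

lemma outer_nth: "outer v $ i $ j = v $ i * cnj (v $ j)"
  by (simp add: outer_def)

lemma outer_mult_vec: "outer v *v w = cinner v w *s v"
  by (simp add: vec_eq_iff matrix_vector_mult_def outer_nth cinner_def sum_distrib_left algebra_simps)

lemma outer_mult_outer: "outer v ** outer w = (\<chi> i j. cinner v w * (v $ i * cnj (w $ j)))"
  by (simp add: vec_eq_iff matrix_mult_nth outer_nth cinner_def sum_distrib_left algebra_simps)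

lemma trace_outer_mult: "trace (outer v ** N) = cinner v (N *v v)"
  by (simp add: trace_matrix_mult cinner_def matrix_vector_mult_def outer_nth sum_distrib_left algebra_simps)
    (rule sum.swap)

lemma trace_outer: "trace (outer v) = cinner v v"
  by (simp add: trace_def outer_nth cinner_def mult.commute)

lemma psd_outer: "psd (outer v)"
proof -
  have "cinner w (outer v *v w) = cinner v w * cnj (cinner v w)" for w
    by (simp add: outer_mult_vec cinner_scale_right cinner_commute[of v w])
  then show ?thesis
    by (simp add: psd_cinner hermitian_def vec_eq_iff outer_nth mult.commute complex_mult_cnj)
qed

lemma trace_hermitian_mult_real:
  assumes "hermitian A" "hermitian B"
  shows "trace (A ** B) = of_real (Re (trace (A ** B)))"
proof -
  have "cnj (trace (A ** B)) = trace (B ** A)"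
    using assms by (simp add: hermitian_def dagger_matrix_mult flip: trace_dagger)
  also have "\<dots> = trace (A ** B)"
    by (rule trace_mul_sym)
  finally show ?thesis
    by (simp add: complex_eq_iff)
qed

text \<open>The quadratic form of \<open>N\<close> at \<alpha> e_i + \<beta> b, expanded. It
  supplies the squares of the two-copy dual, with e_i an unexcited basis state and \<open>b\<close>
  a vector with one excitation.\<close>

lemma psd_axis_combination:
  assumes "psd N"
  shows "0 \<le> (cmod \<alpha>)\<^sup>2 * Re (N $ i $ i) + 2 * Re (cnj \<alpha> * \<beta> * (N *v b) $ i)
    + (cmod \<beta>)\<^sup>2 * Re (cinner b (N *v b))"
proof -
  let ?a = "axis i (1 :: complex)"
  let ?v = "\<alpha> *s ?a + \<beta> *s b"
  have "cinner b (N *v ?a) = cnj ((N *v b) $ i)"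
    using cinner_psd_commute[OF assms, of b ?a] by (simp add: cinner_axis)
  then have "cinner ?v (N *v ?v) = of_real ((cmod \<alpha>)\<^sup>2) * N $ i $ i + (cnj \<alpha> * \<beta> * (N *v b) $ i
      + cnj (cnj \<alpha> * \<beta> * (N *v b) $ i)) + of_real ((cmod \<beta>)\<^sup>2) * cinner b (N *v b)"
    unfolding complex_norm_square
    by (simp add: matrix_vector_right_distrib vector_scalar_commute cinner_add_left cinner_add_right
        cinner_scale_left cinner_scale_right cinner_axis matrix_vector_mult_axis column_def algebra_simps)
  moreover have "0 \<le> Re (cinner ?v (N *v ?v))"
    using assms by (simp add: psd_cinner)
  ultimately show ?thesis
    by (simp add: algebra_simps)
qed

lemma trace_mse_matrix:
  "trace (mat 1 ** mse_matrix S K M est) = (\<Sum>k<K. Re (trace (S ** M k)) * (\<Sum>\<mu>\<in>UNIV. (est k $ \<mu>)\<^sup>2))"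
proof -
  have "trace (mat 1 ** mse_matrix S K M est) = (\<Sum>\<mu>\<in>UNIV. \<Sum>k<K. Re (trace (S ** M k)) * (est k $ \<mu>)\<^sup>2)"
    by (simp add: trace_def mse_matrix_def power2_eq_square mult.assoc)
  also have "\<dots> = (\<Sum>k<K. \<Sum>\<mu>\<in>UNIV. Re (trace (S ** M k)) * (est k $ \<mu>)\<^sup>2)"
    by (rule sum.swap)
  finally show ?thesis
    by (simp add: sum_distrib_left)
qed

text \<open>Weak duality for the semidefinite programme defining the optimum with weight \<open>mat 1\<close>: \<open>a\<close> and \<open>Q\<close> form a
  dual feasible point if the operators \<open>\<parallel>e\<parallel>\<^sup>2 \<sigma>\<^sub>0 - \<Sum>\<^sub>\<mu> a\<^sub>\<mu> e\<^sub>\<mu> D\<^sub>\<mu> + Q\<close> are nonnegative against all psd operators.\<close>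

lemma locally_unbiased_weak_duality:
  assumes est: "locally_unbiased \<sigma> K M est"
    and dual: "\<And>(e :: real^'p) N. psd N \<Longrightarrow>
      0 \<le> (\<Sum>\<mu>\<in>UNIV. (e $ \<mu>)\<^sup>2) * Re (trace (\<sigma> 0 ** N))
        - (\<Sum>\<mu>\<in>UNIV. a \<mu> * e $ \<mu> * Re (trace (partial0 \<sigma> \<mu> ** N))) + Re (trace (Q ** N))"
  shows "(\<Sum>\<mu>\<in>UNIV. a \<mu>) - Re (trace Q) \<le> trace (mat 1 ** mse_matrix (\<sigma> 0) K M est)"
proof -
  have psd: "psd (M k)" if "k < K" for k
    using est that by (simp add: locally_unbiased_def povm_def)
  have one: "(\<Sum>k<K. M k) = mat 1"
    using est by (simp add: locally_unbiased_def povm_def)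
  have D: "(\<Sum>k<K. Re (trace (partial0 \<sigma> \<mu> ** M k)) * est k $ \<mu>) = 1" for \<mu>
  proof -
    have "(\<Sum>k<K. trace (partial0 \<sigma> \<mu> ** M k) * of_real (est k $ \<mu>)) = 1"
      using est by (simp add: locally_unbiased_def)
    from arg_cong[OF this, of Re] show ?thesis
      by simp
  qed
  have "trace Q = trace (Q ** (\<Sum>k<K. M k))"
    by (simp add: one)
  also have "Q ** (\<Sum>k<K. M k) = (\<Sum>k<K. Q ** M k)"
    by (induction K) (simp_all add: matrix_add_ldistrib)
  finally have Q: "Re (trace Q) = (\<Sum>k<K. Re (trace (Q ** M k)))"
    by (simp add: trace_sum)
  have "0 \<le> (\<Sum>k<K. (\<Sum>\<mu>\<in>UNIV. (est k $ \<mu>)\<^sup>2) * Re (trace (\<sigma> 0 ** M k))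
      - (\<Sum>\<mu>\<in>UNIV. a \<mu> * est k $ \<mu> * Re (trace (partial0 \<sigma> \<mu> ** M k))) + Re (trace (Q ** M k)))"
    by (intro sum_nonneg dual psd) simp
  also have "\<dots> = trace (mat 1 ** mse_matrix (\<sigma> 0) K M est)
      - (\<Sum>k<K. \<Sum>\<mu>\<in>UNIV. a \<mu> * est k $ \<mu> * Re (trace (partial0 \<sigma> \<mu> ** M k))) + Re (trace Q)"
    unfolding trace_mse_matrix Q by (simp add: sum.distrib sum_subtractf mult.commute)
  also have "(\<Sum>k<K. \<Sum>\<mu>\<in>UNIV. a \<mu> * est k $ \<mu> * Re (trace (partial0 \<sigma> \<mu> ** M k)))
      = (\<Sum>\<mu>\<in>UNIV. \<Sum>k<K. a \<mu> * est k $ \<mu> * Re (trace (partial0 \<sigma> \<mu> ** M k)))"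
    by (rule sum.swap)
  also have "\<dots> = (\<Sum>\<mu>\<in>UNIV. a \<mu> * (\<Sum>k<K. Re (trace (partial0 \<sigma> \<mu> ** M k)) * est k $ \<mu>))"
    by (simp add: sum_distrib_left mult_ac)
  finally show ?thesis
    by (simp add: D)
qed

text \<open>Estimators are indexed by initial segments of the naturals, while the explicit ones
  carry meaningful labels; a bijection translates. Hermiticity makes all traces real, so
  unbiasedness can be checked on real parts.\<close>

lemma labelled_estimator:
  fixes M :: "'l::finite \<Rightarrow> 'h::finite operator" and est :: "'l \<Rightarrow> real^'p"
  assumes psd: "\<And>l. psd (M l)" and one: "(\<Sum>l\<in>UNIV. M l) = mat 1"
    and herm: "hermitian (\<sigma> 0)" "\<And>\<mu>. hermitian (partial0 \<sigma> \<mu>)"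
    and unbiased: "\<And>\<mu>. (\<Sum>l\<in>UNIV. Re (trace (\<sigma> 0 ** M l)) * est l $ \<mu>) = 0"
      "\<And>\<mu> \<nu>. (\<Sum>l\<in>UNIV. Re (trace (partial0 \<sigma> \<nu> ** M l)) * est l $ \<mu>) = (if \<mu> = \<nu> then 1 else 0)"
  obtains K M' est' where "locally_unbiased \<sigma> K M' est'"
    "trace (mat 1 ** mse_matrix (\<sigma> 0) K M' est')
      = (\<Sum>l\<in>UNIV. Re (trace (\<sigma> 0 ** M l)) * (\<Sum>\<mu>\<in>UNIV. (est l $ \<mu>)\<^sup>2))"
    "(\<And>l l'. M l ** M l' = (if l = l' then M l else 0)) \<Longrightarrow> projective_measurement K M'"
proof -
  obtain h where h: "bij_betw h {..<CARD('l)} (UNIV :: 'l set)"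
    using ex_bij_betw_nat_finite[of "UNIV :: 'l set"] by (auto simp: lessThan_atLeast0)
  have sum: "(\<Sum>k<CARD('l). g (h k)) = (\<Sum>l\<in>UNIV. g l)" for g :: "'l \<Rightarrow> 'b::comm_monoid_add"
    using sum.reindex_bij_betw[OF h] .
  let ?M = "\<lambda>k. M (h k)" and ?est = "\<lambda>k. est (h k)"
  have povm: "povm CARD('l) ?M"
    by (simp add: povm_def psd sum[of M] one)
  have tr: "(\<Sum>k<CARD('l). trace (A ** ?M k) * of_real (?est k $ \<mu>))
      = of_real (\<Sum>l\<in>UNIV. Re (trace (A ** M l)) * est l $ \<mu>)" if "hermitian A" for A \<mu>
  proof -
    have "trace (A ** M l) * of_real (est l $ \<mu>) = of_real (Re (trace (A ** M l)) * est l $ \<mu>)" for l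
      using trace_hermitian_mult_real[OF that, of "M l"] psd[of l] by (simp add: psd_def)
    then show ?thesis
      unfolding of_real_sum sum[of "\<lambda>l. trace (A ** M l) * of_real (est l $ \<mu>)"] by (simp only:)
  qed
  show ?thesis
  proof (rule that)
    show "locally_unbiased \<sigma> CARD('l) ?M ?est"
      by (simp add: locally_unbiased_def povm tr herm unbiased)
    show "trace (mat 1 ** mse_matrix (\<sigma> 0) CARD('l) ?M ?est)
      = (\<Sum>l\<in>UNIV. Re (trace (\<sigma> 0 ** M l)) * (\<Sum>\<mu>\<in>UNIV. (est l $ \<mu>)\<^sup>2))"
      unfolding trace_mse_matrix by (rule sum)
    show "projective_measurement CARD('l) ?M" if "\<And>l l'. M l ** M l' = (if l = l' then M l else 0)"
      using bij_betw_imp_inj_on[OF h] by (auto simp: projective_measurement_def povm that inj_on_def)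
  qed
qed

lemma finite_copy_optimum_eqI:
  fixes \<rho> :: "real^'p \<Rightarrow> 'h::finite operator"
  defines "\<sigma> \<equiv> \<lambda>\<theta>. tensor_power (\<rho> \<theta>) :: ('n::finite \<Rightarrow> 'h) operator"
  assumes lower: "\<And>K M est. locally_unbiased \<sigma> K M est \<Longrightarrow> v \<le> trace (W ** mse_matrix (\<sigma> 0) K M est)"
    and est: "locally_unbiased \<sigma> K M est" "trace (W ** mse_matrix (\<sigma> 0) K M est) = v"
  shows "finite_copy_optimum TYPE('n) \<rho> W = ereal (real CARD('n) * v)"
proof -
  have "Inf {ereal (trace (W ** mse_matrix (\<sigma> 0) K M est)) | K M est. locally_unbiased \<sigma> K M est} = ereal v"
  proof (rule antisym)
    show "Inf {ereal (trace (W ** mse_matrix (\<sigma> 0) K M est)) | K M est. locally_unbiased \<sigma> K M est} \<le> ereal v"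
      using est by (intro Inf_lower) auto
    show "ereal v \<le> Inf {ereal (trace (W ** mse_matrix (\<sigma> 0) K M est)) | K M est. locally_unbiased \<sigma> K M est}"
      using lower by (intro Inf_greatest) auto
  qed
  then show ?thesis
    by (simp add: finite_copy_optimum_def \<sigma>_def)
qed

lemma hermitian_nth: "hermitian M \<Longrightarrow> M $ j $ i = cnj (M $ i $ j)"
  by (metis dagger_nth hermitian_def)

lemma psd_hermitian: "psd A \<Longrightarrow> hermitian A"
  by (simp add: psd_def)

lemma hermitian_qubit_rho0: "hermitian qubit_rho0"
  using density_operator_qubit_rho0 by (simp add: density_operator_def psd_def)

lemma hermitian_tangent: "hermitian (tangent \<mu>)"
  unfolding hermitian_def vec_eq_iff split_paired_All forall_2 by (simp add: tangent_nth)

lemma trace_qubit_rho0: "trace (qubit_rho0 ** M) = (M $ (1, 1) $ (1, 1) + M $ (1, 2) $ (1, 2)) / 2"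
  by (simp add: trace_matrix_mult sum_qubit_pair qubit_rho0_nth add_divide_distrib)

text \<open>Only the blocks between the two states of the qubit \<open>r\<close> enter. They are
  adjoint to each other and contribute equally to the real part, which doubles the factor sqrt 2 /
  2.\<close>

lemma Re_trace_tangent:
  assumes "hermitian M"
  shows "Re (trace (tangent 1 ** M)) = sqrt 2 * Im (M $ (1, 1) $ (2, 1) + M $ (1, 2) $ (2, 2))"
    and "Re (trace (tangent 2 ** M)) = sqrt 2 * Re (M $ (1, 1) $ (2, 1) + M $ (1, 2) $ (2, 2))"
    and "Re (trace (tangent 3 ** M)) = sqrt 2 * Re (M $ (1, 1) $ (2, 2) + M $ (1, 2) $ (2, 1))"
proof -
  note h = hermitian_nth[OF assms, of "(2, 1)" "(1, 1)"] hermitian_nth[OF assms, of "(2, 2)" "(1, 2)"]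
    hermitian_nth[OF assms, of "(2, 2)" "(1, 1)"] hermitian_nth[OF assms, of "(2, 1)" "(1, 2)"]
  show "Re (trace (tangent 1 ** M)) = sqrt 2 * Im (M $ (1, 1) $ (2, 1) + M $ (1, 2) $ (2, 2))"
    and "Re (trace (tangent 2 ** M)) = sqrt 2 * Re (M $ (1, 1) $ (2, 1) + M $ (1, 2) $ (2, 2))"
    and "Re (trace (tangent 3 ** M)) = sqrt 2 * Re (M $ (1, 1) $ (2, 2) + M $ (1, 2) $ (2, 1))"
    by (simp_all add: trace_matrix_mult sum_qubit_pair tangent_nth h algebra_simps)
qed

section \<open>The Holevo bound\<close>

text \<open>Take adjoints and use cyclicity of the trace. Consequently the imaginary part of
  \<open>Z\<close> is antisymmetric and its trace norm is explicit.\<close>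

lemma Z_matrix_commute:
  assumes S: "hermitian S" and X: "\<And>\<mu>. hermitian (X \<mu>)"
  shows "Z_matrix S X $ \<nu> $ \<mu> = cnj (Z_matrix S X $ \<mu> $ \<nu>)"
proof -
  have "cnj (trace (S ** X \<mu> ** X \<nu>)) = trace (dagger (S ** X \<mu> ** X \<nu>))"
    by (simp add: trace_dagger)
  also have "\<dots> = trace (X \<nu> ** X \<mu> ** S)"
    using S X by (simp add: dagger_matrix_mult hermitian_def matrix_mul_assoc)
  also have "\<dots> = trace (S ** (X \<nu> ** X \<mu>))"
    by (rule trace_mul_sym)
  finally show ?thesis
    by (simp add: Z_matrix_def matrix_mul_assoc)
qed

lemma holevo_value_mat_1:
  fixes X :: "3 \<Rightarrow> 'h::finite operator"
  assumes "hermitian (\<rho> 0)" "\<And>\<mu>. hermitian (X \<mu>)"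
  defines "Z \<equiv> Z_matrix (\<rho> 0) X"
  shows "holevo_value \<rho> (mat 1) X = Re (Z $ 1 $ 1) + Re (Z $ 2 $ 2) + Re (Z $ 3 $ 3)
    + 2 * sqrt ((Im (Z $ 1 $ 2))\<^sup>2 + (Im (Z $ 1 $ 3))\<^sup>2 + (Im (Z $ 2 $ 3))\<^sup>2)"
proof -
  note comm = Z_matrix_commute[of "\<rho> 0" X, OF assms(1,2), folded Z_def]
  have one: "map_matrix complex_of_real (mat 1 :: real^3^3) = mat 1"
    by (simp add: vec_eq_iff map_matrix_def mat_def)
  have diag: "Im (Z $ \<mu> $ \<mu>) = 0" for \<mu>
    using comm[of \<mu> \<mu>] by (simp add: complex_eq_iff)
  have "trace_norm (map_matrix (\<lambda>z. complex_of_real (Im z)) Z)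
      = 2 * sqrt ((Im (Z $ 1 $ 2))\<^sup>2 + (Im (Z $ 1 $ 3))\<^sup>2 + (Im (Z $ 2 $ 3))\<^sup>2)"
    by (rule trace_norm_real_antisymmetric)
      (simp_all add: map_matrix_def diag comm[of 1 2] comm[of 1 3] comm[of 2 3])
  then show ?thesis
    unfolding holevo_value_def Let_def one Z_def[symmetric]
    by (simp add: trace_def sum_3)
qed

lemma Re_Z_qubit_rho0:
  assumes "\<And>\<mu>. hermitian (X \<mu>)"
  shows "Re (Z_matrix qubit_rho0 X $ \<mu> $ \<mu>)
    = (\<Sum>j\<in>UNIV. (cmod (X \<mu> $ (1, 1) $ j))\<^sup>2 + (cmod (X \<mu> $ (1, 2) $ j))\<^sup>2) / 2"
proof -
  have "X \<mu> $ i $ j * X \<mu> $ j $ i = of_real ((cmod (X \<mu> $ i $ j))\<^sup>2)" for i j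
    using hermitian_nth[OF assms, of \<mu> j i] by (simp only: complex_norm_square)
  then show ?thesis
    by (simp add: Z_matrix_def trace_qubit_rho0 flip: matrix_mul_assoc) (simp add: matrix_mult_nth sum.distrib)
qed

text \<open>The right-hand side is \<open>Tr (\<rho> Y Y\<^sup>\<dagger>)\<close> for \<open>Y = X\<^sub>1 + \<i> X\<^sub>2\<close>.\<close>

lemma Z_qubit_rho0_12:
  assumes "\<And>\<mu>. hermitian (X \<mu> :: (2 \<times> 2) operator)"
  shows "Re (Z_matrix qubit_rho0 X $ (1::3) $ 1) + Re (Z_matrix qubit_rho0 X $ 2 $ 2) + 2 * Im (Z_matrix qubit_rho0 X $ 1 $ 2)
    = (\<Sum>j\<in>UNIV. (cmod (X 1 $ (1, 1) $ j + \<i> * X 2 $ (1, 1) $ j))\<^sup>2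
        + (cmod (X 1 $ (1, 2) $ j + \<i> * X 2 $ (1, 2) $ j))\<^sup>2) / 2"
proof -
  have sq: "(cmod (a + \<i> * b))\<^sup>2 = (cmod a)\<^sup>2 + (cmod b)\<^sup>2 + 2 * Im (a * cnj b)" for a b
    unfolding cmod_power2 by (simp add: power2_eq_square algebra_simps)
  have "Im (Z_matrix qubit_rho0 X $ 1 $ 2)
      = (\<Sum>j\<in>UNIV. Im (X 1 $ (1, 1) $ j * cnj (X 2 $ (1, 1) $ j)) + Im (X 1 $ (1, 2) $ j * cnj (X 2 $ (1, 2) $ j))) / 2"
    unfolding hermitian_nth[OF assms, of 2 _ "(1, _)", symmetric]
    by (simp add: Z_matrix_def trace_qubit_rho0 flip: matrix_mul_assoc) (simp add: matrix_mult_nth sum.distrib)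
  then show ?thesis
    unfolding Re_Z_qubit_rho0[OF assms] sq sum.distrib sum_distrib_left[symmetric]
    by (simp add: field_simps)
qed

lemma sum_squares_ge: "(x + y)\<^sup>2 / 2 \<le> x\<^sup>2 + (y::real)\<^sup>2"
  using zero_le_power2[of "x - y"] by (simp add: power2_eq_square field_simps)

text \<open>Of the trace norm only the entry (1, 2) is kept. It combines with the first two diagonal
  entries to the squared norm of Y = X_1 + i X_2, at least 1/2; the third diagonal entry is at least
  1/8.\<close>

lemma holevo_value_ge:
  assumes "holevo_feasible qubit_model X"
  shows "5 / 8 \<le> holevo_value qubit_model (mat 1) X"
proof -
  have h: "\<And>\<mu>. hermitian (X \<mu>)"
    using assms by (simp add: holevo_feasible_def)
  have "trace (tangent \<nu> ** X \<mu>) = (if \<mu> = \<nu> then 1 else 0)" for \<mu> \<nu>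
    using assms by (simp add: holevo_feasible_def partial0_qubit_model)
  then have D: "Re (trace (tangent \<mu> ** X \<mu>)) = 1" for \<mu>
    by simp
  let ?Z = "Z_matrix qubit_rho0 X"
  let ?y = "\<lambda>i j. X 1 $ i $ j + \<i> * X 2 $ i $ j"
  \<comment> \<open>Im (X_1 + i X_2) = Im X_1 + Re X_2, so the unbiasedness conditions for theta_1
    and theta_2 add up to one condition on Y.\<close>
  have "sqrt 2 * (Im (?y (1, 1) (2, 1)) + Im (?y (1, 2) (2, 2))) = 2"
    using D[of 1] D[of 2] unfolding Re_trace_tangent[OF h] by (simp add: algebra_simps)
  from arg_cong[OF this, of "\<lambda>x. x\<^sup>2"]
  have "2 * (Im (?y (1, 1) (2, 1)) + Im (?y (1, 2) (2, 2)))\<^sup>2 = 4"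
    unfolding power_mult_distrib by simp
  then have "1 \<le> (Im (?y (1, 1) (2, 1)))\<^sup>2 + (Im (?y (1, 2) (2, 2)))\<^sup>2"
    using sum_squares_ge[of "Im (?y (1, 1) (2, 1))" "Im (?y (1, 2) (2, 2))"] by simp
  also have "\<dots> \<le> (cmod (?y (1, 1) (2, 1)))\<^sup>2 + (cmod (?y (1, 2) (2, 2)))\<^sup>2"
    by (simp add: cmod_power2 add_mono)
  also have "\<dots> \<le> (\<Sum>j\<in>UNIV. (cmod (?y (1, 1) j))\<^sup>2 + (cmod (?y (1, 2) j))\<^sup>2)"
    unfolding sum_qubit_pair by simp
  finally have 12: "1 / 2 \<le> Re (?Z $ 1 $ 1) + Re (?Z $ 2 $ 2) + 2 * Im (?Z $ 1 $ 2)"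
    unfolding Z_qubit_rho0_12[OF h] by simp
  have "sqrt 2 * (Re (X 3 $ (1, 1) $ (2, 2)) + Re (X 3 $ (1, 2) $ (2, 1))) = 1"
    using D[of 3] unfolding Re_trace_tangent[OF h] by simp
  from arg_cong[OF this, of "\<lambda>x. x\<^sup>2"]
  have "2 * (Re (X 3 $ (1, 1) $ (2, 2)) + Re (X 3 $ (1, 2) $ (2, 1)))\<^sup>2 = 1"
    unfolding power_mult_distrib by simp
  then have "1 / 4 \<le> (Re (X 3 $ (1, 1) $ (2, 2)))\<^sup>2 + (Re (X 3 $ (1, 2) $ (2, 1)))\<^sup>2"
    using sum_squares_ge[of "Re (X 3 $ (1, 1) $ (2, 2))" "Re (X 3 $ (1, 2) $ (2, 1))"] by simp
  also have "\<dots> \<le> (cmod (X 3 $ (1, 1) $ (2, 2)))\<^sup>2 + (cmod (X 3 $ (1, 2) $ (2, 1)))\<^sup>2"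
    by (simp add: cmod_power2 add_mono)
  also have "\<dots> \<le> (\<Sum>j\<in>UNIV. (cmod (X 3 $ (1, 1) $ j))\<^sup>2 + (cmod (X 3 $ (1, 2) $ j))\<^sup>2)"
    unfolding sum_qubit_pair by simp
  finally have 33: "1 / 8 \<le> Re (?Z $ 3 $ 3)"
    unfolding Re_Z_qubit_rho0[OF h] by simp
  have "Im (?Z $ 1 $ 2) \<le> sqrt ((Im (?Z $ 1 $ 2))\<^sup>2 + (Im (?Z $ 1 $ 3))\<^sup>2 + (Im (?Z $ 2 $ 3))\<^sup>2)"
    by (intro real_le_rsqrt) simp
  then show ?thesis
    using 12 33 by (simp add: holevo_value_mat_1 h qubit_model_0 hermitian_qubit_rho0)
qed

lemma trace_tangent_tangent: "trace (tangent \<nu> ** tangent \<mu>) = (if \<mu> = \<nu> then 2 else 0)"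
proof -
  have "\<forall>\<mu> \<nu>. trace (tangent \<nu> ** tangent \<mu>) = (if \<mu> = \<nu> then 2 else 0)"
    unfolding forall_3
    by (simp add: trace_matrix_mult sum_qubit_pair tangent_nth complex_eq_iff)
  then show ?thesis
    by blast
qed

text \<open>The tangents are orthogonal with squared norm 2 for the trace form, so their halves are
  the dual system. They give equality in every estimate of \<open>holevo_value_ge\<close>.\<close>

definition holevo_point :: "3 \<Rightarrow> (2 \<times> 2) operator" where
  "holevo_point \<mu> = (1 / 2) *\<^sub>R tangent \<mu>"

lemma holevo_feasible_holevo_point: "holevo_feasible qubit_model holevo_point"
proof -
  have "trace (qubit_rho0 ** holevo_point \<mu>) = 0" for \<mu>
    by (simp add: trace_qubit_rho0 holevo_point_def tangent_nth)
  moreover have "hermitian (holevo_point \<mu>)" for \<mu>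
    using hermitian_tangent[of \<mu>] by (simp add: hermitian_def holevo_point_def dagger_scaleR)
  ultimately show ?thesis
    by (simp add: holevo_feasible_def qubit_model_0 partial0_qubit_model)
      (simp add: holevo_point_def matrix_mult_scaleR_right trace_scaleR trace_tangent_tangent complex_eq_iff)
qed

lemma holevo_value_holevo_point: "holevo_value qubit_model (mat 1) holevo_point = 5 / 8"
proof -
  let ?Z = "Z_matrix qubit_rho0 holevo_point"
  have Z: "?Z $ \<mu> $ \<nu> = trace (qubit_rho0 ** (tangent \<mu> ** tangent \<nu>)) / 4" for \<mu> \<nu>
    by (simp add: Z_matrix_def holevo_point_def matrix_mult_scaleR_right matrix_mult_scaleR_left trace_scaleR
        complex_eq_iff flip: matrix_mul_assoc)
  have Z_entries: "?Z $ 1 $ 1 = 1 / 8" "?Z $ 2 $ 2 = 1 / 8" "?Z $ 3 $ 3 = 1 / 8" "?Z $ 1 $ 2 = \<i> / 8"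
    "?Z $ 1 $ 3 = 0" "?Z $ 2 $ 3 = 0"
    by (simp_all add: Z trace_qubit_rho0 matrix_mult_nth sum_qubit_pair tangent_nth complex_eq_iff)
  have "hermitian (holevo_point \<mu>)" for \<mu>
    using holevo_feasible_holevo_point by (simp add: holevo_feasible_def)
  then show ?thesis
    by (simp add: holevo_value_mat_1 qubit_model_0 hermitian_qubit_rho0 Z_entries)
qed

lemma holevo_bound_qubit_model: "holevo_bound qubit_model (mat 1) = ereal (5 / 8)"
  unfolding holevo_bound_def
proof (rule antisym)
  show "Inf {ereal (holevo_value qubit_model (mat 1) X) | X. holevo_feasible qubit_model X} \<le> ereal (5 / 8)"
    using holevo_feasible_holevo_point holevo_value_holevo_point
    by (intro Inf_lower) (auto intro!: exI[of _ holevo_point])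
  show "ereal (5 / 8) \<le> Inf {ereal (holevo_value qubit_model (mat 1) X) | X. holevo_feasible qubit_model X}"
    by (intro Inf_greatest) (auto dest!: holevo_value_ge)
qed

text \<open>Pairing a vanishing combination with one tangent isolates its coefficient, by
  orthogonality.\<close>

lemma locally_identifiable_qubit_model: "locally_identifiable qubit_model"
proof -
  have inj: "inj tangent"
  proof (rule injI)
    fix \<mu> \<nu> assume "tangent \<mu> = tangent \<nu>"
    then show "\<mu> = \<nu>"
      using trace_tangent_tangent[of \<mu> \<mu>] trace_tangent_tangent[of \<mu> \<nu>] by (auto split: if_splits)
  qed
  have "\<forall>v\<in>range tangent. u v = 0" if "(\<Sum>v\<in>range tangent. u v *\<^sub>R v) = 0" for u
  proof
    fix v assume "v \<in> range tangent"
    then obtain \<mu> where v: "v = tangent \<mu>"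
      by blast
    have "(\<Sum>\<nu>\<in>UNIV. u (tangent \<nu>) *\<^sub>R tangent \<nu>) = 0"
      using that by (simp add: sum.reindex[OF inj])
    then have "0 = trace ((\<Sum>\<nu>\<in>UNIV. u (tangent \<nu>) *\<^sub>R tangent \<nu>) ** tangent \<mu>)"
      by (simp add: trace_def)
    also have "\<dots> = (\<Sum>\<nu>\<in>UNIV. u (tangent \<nu>) *\<^sub>R trace (tangent \<nu> ** tangent \<mu>))"
      by (simp add: sum_3 matrix_mult_add_left trace_add matrix_mult_scaleR_left trace_scaleR)
    also have "\<dots> = 2 * u (tangent \<mu>)"
      by (simp add: trace_tangent_tangent scaleR_conv_of_real if_distrib cong: if_cong)
    finally show "u v = 0"
      by (simp add: v)
  qed
  then have "independent (range tangent)"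
    unfolding dependent_finite[OF finite_imageI[OF finite]] by blast
  then show ?thesis
    using inj by (simp add: locally_identifiable_def partial0_qubit_model[abs_def])
qed

section \<open>Identification of the one-fold tensor power with the space itself\<close>

lemma fun_1_eq_iff: "i = j \<longleftrightarrow> i 1 = j 1" for i j :: "1 \<Rightarrow> 'a"
  by (simp add: fun_eq_iff)

lemma sum_fun_1: "(\<Sum>i\<in>UNIV. f i) = (\<Sum>a\<in>UNIV. f (\<lambda>_. a))"
  for f :: "(1 \<Rightarrow> 'a::finite) \<Rightarrow> 'b::comm_monoid_add"
  by (rule sum.reindex_bij_witness[where i = "\<lambda>a _. a" and j = "\<lambda>i. i 1"]) (auto simp: fun_1_eq_iff intro!: arg_cong[of _ _ f])

definition single_copy :: "(1 \<Rightarrow> 'h::finite) operator \<Rightarrow> 'h operator" where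
  "single_copy N = (\<chi> a b. N $ (\<lambda>_. a) $ (\<lambda>_. b))"

lemma single_copy_tensor_power [simp]: "single_copy (tensor_power A) = A"
  by (simp add: single_copy_def tensor_power_1 vec_eq_iff)

lemma trace_tensor_power_1_mult:
  "trace ((tensor_power A :: (1 \<Rightarrow> 'h::finite) operator) ** N) = trace (A ** single_copy N)"
  by (simp add: trace_matrix_mult sum_fun_1 tensor_power_1 single_copy_def)

lemma trace_tensor_power_1: "trace (tensor_power A :: (1 \<Rightarrow> 'h::finite) operator) = trace A"
  by (simp add: trace_def sum_fun_1 tensor_power_1)

lemma psd_single_copy:
  assumes "psd N"
  shows "psd (single_copy N)"
proof -
  have "cinner v (single_copy N *v v) = cinner (\<chi> i. v $ i 1) (N *v (\<chi> i. v $ i 1))" for v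
    by (simp add: cinner_def matrix_vector_mult_def sum_fun_1 single_copy_def)
  then show ?thesis
    using assms by (simp add: psd_cinner hermitian_def vec_eq_iff single_copy_def)
qed

lemma hermitian_tensor_power: "hermitian A \<Longrightarrow> hermitian (tensor_power A)"
  by (simp add: hermitian_def tensor_power_def vec_eq_iff cnj_prod)

lemma partial0_single_copy:
  "partial0 (\<lambda>\<theta>. tensor_power (qubit_model \<theta>) :: (1 \<Rightarrow> 2 \<times> 2) operator) \<mu> = tensor_power (tangent \<mu>)"
  by (rule partial0_tensor_power_1) (rule has_vector_derivative_qubit_model)

section \<open>One copy\<close>

lemma psd_quadratic_form:
  assumes "psd M"
  shows "0 \<le> Re (\<Sum>i\<in>UNIV. \<Sum>j\<in>UNIV. cnj (v i) * M $ i $ j * v j)"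
proof -
  have "0 \<le> Re (cinner (\<chi> i. v i) (M *v (\<chi> i. v i)))"
    using assms by (simp only: psd_cinner)
  also have "cinner (\<chi> i. v i) (M *v (\<chi> i. v i)) = (\<Sum>i\<in>UNIV. \<Sum>j\<in>UNIV. cnj (v i) * M $ i $ j * v j)"
    by (simp add: cinner_def matrix_vector_mult_def sum_distrib_left mult.assoc)
  finally show ?thesis .
qed

text \<open>The right-hand side is the sum of the values of \<open>M\<close> on four vectors, two for each basis vector of
  the qubit \<open>t\<close>.\<close>

lemma single_copy_dual_feasible:
  fixes e1 e2 e3 s :: real
  assumes M: "psd (M :: (2 \<times> 2) operator)"
  shows "0 \<le> (e1\<^sup>2 + e2\<^sup>2 + e3\<^sup>2) * Re ((M $ (1, 1) $ (1, 1) + M $ (1, 2) $ (1, 2)) / 2)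
    - s * (sqrt 2 * e1 * Im (M $ (1, 1) $ (2, 1) + M $ (1, 2) $ (2, 2))
      + e2 * Re (M $ (1, 1) $ (2, 1) + M $ (1, 2) $ (2, 2))
      + e3 * Re (M $ (1, 1) $ (2, 2) + M $ (1, 2) $ (2, 1)))
    + s\<^sup>2 * Re (M $ (2, 1) $ (2, 1) + M $ (2, 2) $ (2, 2))"
proof -
  have herm: "M $ j $ i = cnj (M $ i $ j)" for i j
    by (rule hermitian_nth[OF psd_hermitian[OF M]])
  note h = herm[of "(2, 1)" "(1, 1)"] herm[of "(2, 2)" "(1, 2)"]
    herm[of "(2, 2)" "(1, 1)"] herm[of "(2, 1)" "(1, 2)"] herm[of "(1, 2)" "(1, 1)"] herm[of "(2, 2)" "(2, 1)"]
  have diag: "Im (M $ i $ i) = 0" for i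
    using herm[of i i] by (simp add: complex_eq_iff)
  define k where "k = sqrt 2 / 2"
  have k: "k * k = 1 / 2" "k * (k * x) = x / 2" "sqrt 2 = 2 * k" for x
    by (simp_all add: k_def)
  let ?x = "- Complex (e2 / 2) (e1 * k)" and ?y = "- Complex (e3 / 2) 0"
  have 1: "0 \<le> Re (\<Sum>i\<in>UNIV. \<Sum>j\<in>UNIV. cnj (v i) * M $ i $ j * v j)" for v
    using M by (rule psd_quadratic_form)
  let ?v1 = "\<lambda>i. if i = (2, 1) then of_real s else if i = (1, 1) then ?x else if i = (1, 2) then ?y else 0"
  let ?v2 = "\<lambda>i. if i = (2, 2) then of_real s else if i = (1, 2) then ?x else if i = (1, 1) then ?y else 0"
  \<comment> \<open>The first two vectors give only half of the required weight of
    \<open>e2\<^sup>2\<close> and \<open>e3\<^sup>2\<close> and leave a mixed term in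
    \<open>e2 * e3\<close>; these two supply the missing half and cancel the mixed term.\<close>
  let ?w1 = "\<lambda>i. if i = (1, 1) then of_real (e2 / 2) else if i = (1, 2) then of_real (- e3 / 2) else 0"
  let ?w2 = "\<lambda>i. if i = (1, 2) then of_real (e2 / 2) else if i = (1, 1) then of_real (- e3 / 2) else 0"
  show ?thesis
    using 1[of ?v1] 1[of ?v2] 1[of ?w1] 1[of ?w2]
    unfolding k(3)
    by (simp add: sum_qubit_pair h diag algebra_simps power2_eq_square k(1,2) add_divide_distrib)
qed

lemma single_copy_mse_ge:
  assumes "locally_unbiased (\<lambda>\<theta>. tensor_power (qubit_model \<theta>) :: (1 \<Rightarrow> 2 \<times> 2) operator) K M est"
  shows "(3 + 2 * sqrt 2) / 8 \<le> trace (mat 1 ** mse_matrix (tensor_power (qubit_model 0)) K M est)"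
proof -
  \<comment> \<open>The dual value is s (1 + sqrt 2) - 2 s^2, which is maximal at this
    \<open>s\<close>.\<close>
  define s where "s = (1 + sqrt 2) / 4"
  define Q :: "(2 \<times> 2) operator" where "Q = (\<chi> i j. if i = j \<and> fst i = 2 then of_real (s\<^sup>2) else 0)"
  define a :: "3 \<Rightarrow> real" where "a = (\<lambda>\<mu>. if \<mu> = 1 then s else s * (sqrt 2 / 2))"
  have Q: "trace (Q ** N) = of_real (s\<^sup>2) * (N $ (2, 1) $ (2, 1) + N $ (2, 2) $ (2, 2))" for N
    by (simp add: trace_matrix_mult sum_qubit_pair Q_def algebra_simps)
  have sqrt2: "sqrt 2 * (sqrt 2 * x) = 2 * x" for x
    by (simp flip: mult.assoc)
  have "(\<Sum>\<mu>\<in>UNIV. a \<mu>) - Re (trace (tensor_power Q :: (1 \<Rightarrow> 2 \<times> 2) operator))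
      \<le> trace (mat 1 ** mse_matrix (tensor_power (qubit_model 0)) K M est)"
  proof (rule locally_unbiased_weak_duality[OF assms])
    fix e :: "real^3" and N :: "(1 \<Rightarrow> 2 \<times> 2) operator"
    assume "psd N"
    then have N: "psd (single_copy N)"
      by (rule psd_single_copy)
    show "0 \<le> (\<Sum>\<mu>\<in>UNIV. (e $ \<mu>)\<^sup>2) * Re (trace (tensor_power (qubit_model 0) ** N))
        - (\<Sum>\<mu>\<in>UNIV. a \<mu> * e $ \<mu> *
            Re (trace (partial0 (\<lambda>\<theta>. tensor_power (qubit_model \<theta>) :: (1 \<Rightarrow> 2 \<times> 2) operator) \<mu> ** N)))
        + Re (trace (tensor_power Q ** N))"
      unfolding partial0_single_copy trace_tensor_power_1_mult sum_3 qubit_model_0 trace_qubit_rho0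
        Re_trace_tangent[OF psd_hermitian[OF N]] Q
      using single_copy_dual_feasible[OF N, of "e $ 1" "e $ 2" "e $ 3" s]
      by (simp add: a_def algebra_simps sqrt2)
  qed
  moreover have "(\<Sum>\<mu>\<in>UNIV. a \<mu>) - Re (trace (tensor_power Q :: (1 \<Rightarrow> 2 \<times> 2) operator)) = (3 + 2 * sqrt 2) / 8"
    unfolding trace_tensor_power_1
    by (simp add: trace_def sum_qubit_pair Q_def sum_3 a_def s_def power2_eq_square algebra_simps)
  ultimately show ?thesis
    by simp
qed

definition sg :: "2 \<Rightarrow> real" where
  "sg k = (if k = 1 then 1 else -1)"

text \<open>Outcome \<open>(s, d, r)\<close>: the qubit \<open>t\<close> is found in the state \<open>|\<plusminus>\<rangle>\<close>, with sign \<open>s\<close>; on the qubit \<open>r\<close>,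
  the observable \<open>- \<sigma>\<^sub>y\<close> (\<open>d = 1\<close>) or \<open>\<sigma>\<^sub>x\<close> (\<open>d = 2\<close>) is measured, with the result \<open>sg r\<close>. The former is chosen
  with probability \<open>\<surd>2 - 1\<close>, which minimizes the error \<open>(1 / p + 2 / (1 - p)) / 8\<close>.\<close>

definition single_copy_vec :: "2 \<times> 2 \<times> 2 \<Rightarrow> complex^(2 \<times> 2)" where
  "single_copy_vec l = (case l of (s, d, r) \<Rightarrow> \<chi> i.
     (if fst i = 1 then 1 else if d = 1 then - \<i> * of_real (sg r) else of_real (sg r)) / 2
     * (if snd i = 1 then 1 else of_real (sg s)))"

definition single_copy_weight :: "2 \<times> 2 \<times> 2 \<Rightarrow> real" where
  "single_copy_weight l = (case l of (s, d, r) \<Rightarrow> if d = 1 then sqrt 2 - 1 else 2 - sqrt 2)"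

definition single_copy_povm :: "2 \<times> 2 \<times> 2 \<Rightarrow> (2 \<times> 2) operator" where
  "single_copy_povm l = single_copy_weight l *\<^sub>R outer (single_copy_vec l)"

text \<open>Unbiasedness fixes the scale: if the setting \<open>d\<close> has probability p, its
  four outcomes respond to each of its parameters with total strength 2 sqrt 2 p, and the scale is
  the reciprocal.\<close>

definition single_copy_est :: "2 \<times> 2 \<times> 2 \<Rightarrow> real^3" where
  "single_copy_est l = (case l of (s, d, r) \<Rightarrow> \<chi> \<mu>.
     if \<mu> = 1 then if d = 1 then sg r * (2 + sqrt 2) / 4 else 0
     else if d = 1 then 0
     else if \<mu> = 2 then sg r * (1 + sqrt 2) / 4 else sg s * sg r * (1 + sqrt 2) / 4)"

lemma sum_three_bits: "(\<Sum>l\<in>UNIV. f l) = (\<Sum>d\<in>UNIV. \<Sum>r\<in>UNIV. \<Sum>s\<in>UNIV. f (s, d, r))"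
  for f :: "2 \<times> 2 \<times> 2 \<Rightarrow> 'a::comm_monoid_add"
proof -
  have "(\<Sum>l\<in>UNIV. f l) = (\<Sum>s\<in>UNIV. \<Sum>p\<in>UNIV. f (s, p))"
    by (simp add: sum.cartesian_product)
  then show ?thesis
    by (simp add: sum_qubit_pair sum_2 ac_simps)
qed

lemma psd_single_copy_povm:
  "psd (single_copy_povm l)" "psd (tensor_power (single_copy_povm l) :: (1 \<Rightarrow> 2 \<times> 2) operator)"
proof -
  have w: "0 \<le> single_copy_weight l"
    using sqrt2_less_2 by (simp add: single_copy_weight_def split: prod.split)
  then show "psd (single_copy_povm l)"
    by (simp add: single_copy_povm_def psd_scaleR psd_outer)
  have "(tensor_power (single_copy_povm l) :: (1 \<Rightarrow> 2 \<times> 2) operator)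
      = single_copy_weight l *\<^sub>R outer (\<chi> i. single_copy_vec l $ i 1)"
    by (simp add: vec_eq_iff tensor_power_1 single_copy_povm_def outer_nth)
  then show "psd (tensor_power (single_copy_povm l) :: (1 \<Rightarrow> 2 \<times> 2) operator)"
    by (simp add: w psd_scaleR psd_outer)
qed

lemma sum_single_copy_povm: "(\<Sum>l\<in>UNIV. single_copy_povm l) = mat 1"
  unfolding vec_eq_iff split_paired_All forall_2
  by (simp add: sum_three_bits sum_2 single_copy_povm_def single_copy_weight_def outer_nth single_copy_vec_def
      sg_def mat_def complex_eq_iff)

lemma single_copy_povm_traces:
  "Re (trace (qubit_rho0 ** single_copy_povm l)) = single_copy_weight l / 4"
  "Re (trace (tangent 1 ** single_copy_povm l)) = (case l of (s, d, r) \<Rightarrow>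
     if d = 1 then sg r * single_copy_weight l * sqrt 2 / 2 else 0)"
  "Re (trace (tangent 2 ** single_copy_povm l)) = (case l of (s, d, r) \<Rightarrow>
     if d = 1 then 0 else sg r * single_copy_weight l * sqrt 2 / 2)"
  "Re (trace (tangent 3 ** single_copy_povm l)) = (case l of (s, d, r) \<Rightarrow>
     if d = 1 then 0 else sg s * sg r * single_copy_weight l * sqrt 2 / 2)"
  unfolding Re_trace_tangent[OF psd_hermitian[OF psd_single_copy_povm(1)]] trace_qubit_rho0
  by (auto simp: single_copy_povm_def outer_nth single_copy_vec_def sg_def split: prod.split)

lemma finite_copy_optimum_1:
  "finite_copy_optimum TYPE(1) qubit_model (mat 1) = ereal ((3 + 2 * sqrt 2) / 8)"
proof -
  let ?\<sigma> = "\<lambda>\<theta>. tensor_power (qubit_model \<theta>) :: (1 \<Rightarrow> 2 \<times> 2) operator"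
  have one: "(\<Sum>l\<in>UNIV. tensor_power (single_copy_povm l) :: (1 \<Rightarrow> 2 \<times> 2) operator) = mat 1"
  proof -
    have "(\<Sum>l\<in>UNIV. single_copy_povm l $ i $ j) = mat 1 $ i $ j" for i j
      using arg_cong[OF sum_single_copy_povm, of "\<lambda>A. A $ i $ j"] by simp
    then show ?thesis
      by (simp add: vec_eq_iff tensor_power_1 mat_def fun_1_eq_iff)
  qed
  have unbiased_0: "\<forall>\<mu>. (\<Sum>l\<in>UNIV. Re (trace (?\<sigma> 0 ** tensor_power (single_copy_povm l))) * single_copy_est l $ \<mu>) = 0"
    unfolding trace_tensor_power_1_mult single_copy_tensor_power qubit_model_0 forall_3
    by (simp add: single_copy_povm_traces sum_three_bits sum_2 single_copy_est_def sg_def single_copy_weight_def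
        algebra_simps)
  have unbiased_D: "\<forall>\<mu> \<nu>. (\<Sum>l\<in>UNIV. Re (trace (partial0 ?\<sigma> \<nu> ** tensor_power (single_copy_povm l)))
      * single_copy_est l $ \<mu>) = (if \<mu> = \<nu> then 1 else 0)"
    unfolding partial0_single_copy trace_tensor_power_1_mult single_copy_tensor_power forall_3
    by (simp add: single_copy_povm_traces sum_three_bits sum_2 single_copy_est_def sg_def single_copy_weight_def
        algebra_simps add_divide_distrib diff_divide_distrib)
  have herm: "hermitian (?\<sigma> 0)" "hermitian (partial0 ?\<sigma> \<mu>)" for \<mu>
    by (simp_all only: partial0_single_copy qubit_model_0 hermitian_tensor_power hermitian_qubit_rho0 hermitian_tangent)
  obtain K M est where est: "locally_unbiased ?\<sigma> K M est"
    "trace (mat 1 ** mse_matrix (?\<sigma> 0) K M est) =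
      (\<Sum>l\<in>UNIV. Re (trace (?\<sigma> 0 ** tensor_power (single_copy_povm l))) * (\<Sum>\<mu>\<in>UNIV. (single_copy_est l $ \<mu>)\<^sup>2))"
    by (rule labelled_estimator[OF psd_single_copy_povm(2) one herm unbiased_0[rule_format] unbiased_D[rule_format]])
      (erule (1) that)
  note est(2)
  also have "(\<Sum>l\<in>UNIV. Re (trace (?\<sigma> 0 ** tensor_power (single_copy_povm l))) * (\<Sum>\<mu>\<in>UNIV. (single_copy_est l $ \<mu>)\<^sup>2))
      = (3 + 2 * sqrt 2) / 8"
    unfolding trace_tensor_power_1_mult single_copy_tensor_power qubit_model_0
    by (simp add: single_copy_povm_traces sum_three_bits sum_2 sum_3 single_copy_est_def sg_def single_copy_weight_def
        power2_eq_square algebra_simps add_divide_distrib)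
  finally show ?thesis
    using finite_copy_optimum_eqI[OF single_copy_mse_ge est(1)] by simp
qed

section \<open>Two copies\<close>

definition pr :: "'a \<Rightarrow> 'a \<Rightarrow> 2 \<Rightarrow> 'a" where
  "pr a b = (\<lambda>k. if k = 1 then a else b)"

lemma pr_simps [simp]: "pr a b 1 = a" "pr a b 2 = b" "pr a b = pr c d \<longleftrightarrow> a = c \<and> b = d"
  by (auto simp: pr_def fun_eq_iff split: if_splits dest: spec[of _ 1] spec[of _ 2])

lemma pr_eta: "pr (i 1) (i 2) = i"
  using exhaust_2 by (auto simp: pr_def fun_eq_iff)

lemma fun_2_eq_iff: "i = j \<longleftrightarrow> i 1 = j 1 \<and> i 2 = j 2" for i j :: "2 \<Rightarrow> 'a"
  by (metis pr_eta)

lemma sum_fun_2: "(\<Sum>i\<in>UNIV. f i) = (\<Sum>a\<in>UNIV. \<Sum>b\<in>UNIV. f (pr a b))"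
  for f :: "(2 \<Rightarrow> 'a::finite) \<Rightarrow> 'b::comm_monoid_add"
proof -
  have "(\<Sum>i\<in>UNIV. f i) = (\<Sum>p\<in>UNIV \<times> UNIV. f (pr (fst p) (snd p)))"
    by (rule sum.reindex_bij_witness[where i = "\<lambda>p. pr (fst p) (snd p)" and j = "\<lambda>i. (i 1, i 2)"])
      (auto simp: pr_eta)
  then show ?thesis
    by (simp add: sum.cartesian_product split_def)
qed

definition flip :: "2 \<Rightarrow> 2" where
  "flip a = (if a = 1 then 2 else 1)"

lemma flip_simps [simp]: "flip 1 = 2" "flip 2 = 1"
  by (simp_all add: flip_def)

text \<open>\<open>excited a b\<close> is the unnormalized symmetric superposition of the states obtained from \<open>|0 a\<rangle>|0 b\<rangle>\<close>
  by flipping one of the two qubits \<open>r\<close>; in \<open>excited_flip a b\<close> the qubit \<open>t\<close> of that copy is flipped, too.\<close>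

definition excited :: "2 \<Rightarrow> 2 \<Rightarrow> complex^(2 \<Rightarrow> 2 \<times> 2)" where
  "excited a b = axis (pr (2, a) (1, b)) 1 + axis (pr (1, a) (2, b)) 1"

definition excited_flip :: "2 \<Rightarrow> 2 \<Rightarrow> complex^(2 \<Rightarrow> 2 \<times> 2)" where
  "excited_flip a b = axis (pr (2, flip a) (1, b)) 1 + axis (pr (1, a) (2, flip b)) 1"

abbreviation (input) two_copies :: "real^3 \<Rightarrow> (2 \<Rightarrow> 2 \<times> 2) operator" where
  "two_copies \<equiv> \<lambda>\<theta>. tensor_power (qubit_model \<theta>)"

lemma trace_two_copies_0:
  "trace (two_copies 0 ** N) = (\<Sum>a\<in>UNIV. \<Sum>b\<in>UNIV. N $ pr (1, a) (1, b) $ pr (1, a) (1, b)) / 4"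
  by (simp add: trace_matrix_mult sum_fun_2 tensor_power_2 qubit_model_0 sum_qubit_pair qubit_rho0_nth sum_2 algebra_simps
      add_divide_distrib)

lemma sum_qubit_rho0:
  "(\<Sum>a\<in>UNIV. \<Sum>c\<in>UNIV. qubit_rho0 $ a $ c * g a c) = (\<Sum>t\<in>UNIV. g (1, t) (1, t)) / 2"
  by (simp add: sum_qubit_pair sum_2 qubit_rho0_nth add_divide_distrib)

text \<open>In each Leibniz term one copy is still in the initial state, which is diagonal;
  averaging over its two basis states leaves slices of \<open>N\<close> on the other copy, to which
  the one-copy formulas apply.\<close>

lemma trace_first_order:
  fixes T :: "(2 \<times> 2) operator" and N :: "(2 \<Rightarrow> 2 \<times> 2) operator"
  shows "trace ((\<chi> i j. qubit_rho0 $ i 1 $ j 1 * T $ i 2 $ j 2 + T $ i 1 $ j 1 * qubit_rho0 $ i 2 $ j 2) ** N) =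
    (\<Sum>t\<in>UNIV. trace (T ** (\<chi> c a. N $ pr c (1, t) $ pr a (1, t)))
      + trace (T ** (\<chi> c a. N $ pr (1, t) c $ pr (1, t) a))) / 2"
proof -
  let ?\<rho> = "\<lambda>a c. qubit_rho0 $ a $ c" and ?f = "\<lambda>a b c d. N $ pr c d $ pr a b"
  have 1: "(\<Sum>a\<in>UNIV. \<Sum>b\<in>UNIV. \<Sum>c\<in>UNIV. \<Sum>d\<in>UNIV. ?\<rho> a c * (T $ b $ d * ?f a b c d))
      = (\<Sum>t\<in>UNIV. trace (T ** (\<chi> d b. N $ pr (1, t) d $ pr (1, t) b))) / 2"
  proof -
    have "(\<Sum>a\<in>UNIV. \<Sum>b\<in>UNIV. \<Sum>c\<in>UNIV. \<Sum>d\<in>UNIV. ?\<rho> a c * (T $ b $ d * ?f a b c d))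
        = (\<Sum>a\<in>UNIV. \<Sum>c\<in>UNIV. \<Sum>b\<in>UNIV. \<Sum>d\<in>UNIV. ?\<rho> a c * (T $ b $ d * ?f a b c d))"
      by (rule sum.cong[OF refl sum.swap])
    also have "\<dots> = (\<Sum>a\<in>UNIV. \<Sum>c\<in>UNIV. ?\<rho> a c * (\<Sum>b\<in>UNIV. \<Sum>d\<in>UNIV. T $ b $ d * ?f a b c d))"
      by (simp add: sum_distrib_left)
    finally show ?thesis
      by (simp add: sum_qubit_rho0 trace_matrix_mult)
  qed
  have 2: "(\<Sum>a\<in>UNIV. \<Sum>b\<in>UNIV. \<Sum>c\<in>UNIV. \<Sum>d\<in>UNIV. ?\<rho> b d * (T $ a $ c * ?f a b c d))
      = (\<Sum>t\<in>UNIV. trace (T ** (\<chi> c a. N $ pr c (1, t) $ pr a (1, t)))) / 2"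
  proof -
    have "(\<Sum>a\<in>UNIV. \<Sum>b\<in>UNIV. \<Sum>c\<in>UNIV. \<Sum>d\<in>UNIV. ?\<rho> b d * (T $ a $ c * ?f a b c d))
        = (\<Sum>b\<in>UNIV. \<Sum>a\<in>UNIV. \<Sum>c\<in>UNIV. \<Sum>d\<in>UNIV. ?\<rho> b d * (T $ a $ c * ?f a b c d))"
      by (rule sum.swap)
    also have "\<dots> = (\<Sum>b\<in>UNIV. \<Sum>a\<in>UNIV. \<Sum>d\<in>UNIV. \<Sum>c\<in>UNIV. ?\<rho> b d * (T $ a $ c * ?f a b c d))"
      by (rule sum.cong[OF refl sum.cong[OF refl sum.swap]])
    also have "\<dots> = (\<Sum>b\<in>UNIV. \<Sum>d\<in>UNIV. \<Sum>a\<in>UNIV. \<Sum>c\<in>UNIV. ?\<rho> b d * (T $ a $ c * ?f a b c d))"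
      by (rule sum.cong[OF refl sum.swap])
    also have "\<dots> = (\<Sum>b\<in>UNIV. \<Sum>d\<in>UNIV. ?\<rho> b d * (\<Sum>a\<in>UNIV. \<Sum>c\<in>UNIV. T $ a $ c * ?f a b c d))"
      by (simp add: sum_distrib_left)
    finally show ?thesis
      by (simp add: sum_qubit_rho0 trace_matrix_mult)
  qed
  have "trace ((\<chi> i j. qubit_rho0 $ i 1 $ j 1 * T $ i 2 $ j 2 + T $ i 1 $ j 1 * qubit_rho0 $ i 2 $ j 2) ** N) =
      (\<Sum>a\<in>UNIV. \<Sum>b\<in>UNIV. \<Sum>c\<in>UNIV. \<Sum>d\<in>UNIV. ?\<rho> a c * (T $ b $ d * ?f a b c d))
      + (\<Sum>a\<in>UNIV. \<Sum>b\<in>UNIV. \<Sum>c\<in>UNIV. \<Sum>d\<in>UNIV. ?\<rho> b d * (T $ a $ c * ?f a b c d))"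
    unfolding trace_matrix_mult sum_fun_2 sum.distrib[symmetric] by (simp add: algebra_simps)
  then show ?thesis
    unfolding 1 2 by (simp add: sum.distrib add_divide_distrib)
qed

lemma partial0_two_copies:
  "partial0 two_copies \<mu> = (\<chi> i j. qubit_rho0 $ i 1 $ j 1 * tangent \<mu> $ i 2 $ j 2
    + tangent \<mu> $ i 1 $ j 1 * qubit_rho0 $ i 2 $ j 2)"
  using partial0_tensor_power_2[OF has_vector_derivative_qubit_model[of \<mu>]] by (simp add: qubit_model_0)

lemma matrix_vector_mult_excited:
  fixes N :: "(2 \<Rightarrow> 2 \<times> 2) operator"
  shows "(N *v excited a b) $ i = N $ i $ pr (2, a) (1, b) + N $ i $ pr (1, a) (2, b)"
  "(N *v excited_flip a b) $ i = N $ i $ pr (2, flip a) (1, b) + N $ i $ pr (1, a) (2, flip b)"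
  by (simp_all add: excited_def excited_flip_def matrix_vector_right_distrib matrix_vector_mult_axis column_def)

lemma Re_trace_two_copies_derivative:
  assumes N: "hermitian N"
  shows "Re (trace (partial0 two_copies 1 ** N)) =
      sqrt 2 / 2 * (\<Sum>a\<in>UNIV. \<Sum>b\<in>UNIV. Im ((N *v excited a b) $ pr (1, a) (1, b)))"
    and "Re (trace (partial0 two_copies 2 ** N)) =
      sqrt 2 / 2 * (\<Sum>a\<in>UNIV. \<Sum>b\<in>UNIV. Re ((N *v excited a b) $ pr (1, a) (1, b)))"
    and "Re (trace (partial0 two_copies 3 ** N)) =
      sqrt 2 / 2 * (\<Sum>a\<in>UNIV. \<Sum>b\<in>UNIV. Re ((N *v excited_flip a b) $ pr (1, a) (1, b)))"
proof -
  have block: "hermitian (\<chi> c a. N $ pr c t $ pr a t)" "hermitian (\<chi> c a. N $ pr t c $ pr t a)" for t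
    by (simp_all add: hermitian_def vec_eq_iff flip: hermitian_nth[OF N])
  show "Re (trace (partial0 two_copies 1 ** N)) =
      sqrt 2 / 2 * (\<Sum>a\<in>UNIV. \<Sum>b\<in>UNIV. Im ((N *v excited a b) $ pr (1, a) (1, b)))"
    and "Re (trace (partial0 two_copies 2 ** N)) =
      sqrt 2 / 2 * (\<Sum>a\<in>UNIV. \<Sum>b\<in>UNIV. Re ((N *v excited a b) $ pr (1, a) (1, b)))"
    and "Re (trace (partial0 two_copies 3 ** N)) =
      sqrt 2 / 2 * (\<Sum>a\<in>UNIV. \<Sum>b\<in>UNIV. Re ((N *v excited_flip a b) $ pr (1, a) (1, b)))"
    unfolding partial0_two_copies trace_first_order
    by (simp_all add: sum_2 Re_trace_tangent[OF block(1)] Re_trace_tangent[OF block(2)] matrix_vector_mult_excited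
        algebra_simps)
qed

lemma two_copy_mse_ge:
  assumes "locally_unbiased two_copies K M est"
  shows "5 / 16 \<le> trace (mat 1 ** mse_matrix (two_copies 0) K M est)"
proof -
  \<comment> \<open>Completing the squares for coefficients a_1 = a_2 = a and a_3 = b gives weights
    a^2 / 2 and b^2 / 2. The dual value splits into 2 a - 4 a^2 and b - 4 b^2, maximal at a = 1/4
    and b = 1/8.\<close>
  define Q where "Q = (\<Sum>a\<in>UNIV. \<Sum>b\<in>UNIV. (1 / 32) *\<^sub>R outer (excited a b) + (1 / 128) *\<^sub>R outer (excited_flip a b))"
  define a :: "3 \<Rightarrow> real" where "a = (\<lambda>\<mu>. if \<mu> = 3 then 1 / 8 else 1 / 4)"
  have Q: "Re (trace (Q ** N)) = (\<Sum>a\<in>UNIV. \<Sum>b\<in>UNIV. Re (cinner (excited a b) (N *v excited a b)) / 32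
      + Re (cinner (excited_flip a b) (N *v excited_flip a b)) / 128)" for N
    by (simp add: Q_def sum_2 matrix_mult_add_left trace_add matrix_mult_scaleR_left trace_scaleR trace_outer_mult)
  have "(\<Sum>\<mu>\<in>UNIV. a \<mu>) - Re (trace Q) \<le> trace (mat 1 ** mse_matrix (two_copies 0) K M est)"
  proof (rule locally_unbiased_weak_duality[OF assms])
    fix e :: "real^3" and N :: "(2 \<Rightarrow> 2 \<times> 2) operator"
    assume N: "psd N"
    have cmod: "(cmod (Complex x y))\<^sup>2 = x\<^sup>2 + y\<^sup>2" for x y
      by (simp add: cmod_power2)
    \<comment> \<open>One complex coefficient serves theta_1 and theta_2 together, since both pair
      with the same vector, through imaginary and real parts.\<close>
    have 1: "0 \<le> ((e $ 1)\<^sup>2 + (e $ 2)\<^sup>2) * Re (N $ i $ i) - sqrt 2 / 2 * (e $ 1 * Im ((N *v b) $ i) + e $ 2 * Re ((N *v b) $ i))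
        + Re (cinner b (N *v b)) / 8" for i b
      using psd_axis_combination[OF N, of "Complex (e $ 1) (- e $ 2)" i "Complex 0 (sqrt 2 / 4)" b]
      unfolding cmod by (simp add: power_divide algebra_simps)
    have 3: "0 \<le> (e $ 3)\<^sup>2 * Re (N $ i $ i) - sqrt 2 / 4 * e $ 3 * Re ((N *v b) $ i)
        + Re (cinner b (N *v b)) / 32" for i b
      using psd_axis_combination[OF N, of "Complex (e $ 3) 0" i "Complex (- (sqrt 2 / 8)) 0" b]
      unfolding cmod by (simp add: power_divide algebra_simps)
    have "0 \<le> (\<Sum>a\<in>UNIV. \<Sum>b\<in>UNIV.
        (((e $ 1)\<^sup>2 + (e $ 2)\<^sup>2) * Re (N $ pr (1, a) (1, b) $ pr (1, a) (1, b))
          - sqrt 2 / 2 * (e $ 1 * Im ((N *v excited a b) $ pr (1, a) (1, b)) + e $ 2 * Re ((N *v excited a b) $ pr (1, a) (1, b)))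
          + Re (cinner (excited a b) (N *v excited a b)) / 8)
        + ((e $ 3)\<^sup>2 * Re (N $ pr (1, a) (1, b) $ pr (1, a) (1, b))
          - sqrt 2 / 4 * e $ 3 * Re ((N *v excited_flip a b) $ pr (1, a) (1, b))
          + Re (cinner (excited_flip a b) (N *v excited_flip a b)) / 32))" (is "0 \<le> ?R")
      by (intro sum_nonneg add_nonneg_nonneg 1 3)
    also have "?R = 4 * ((\<Sum>\<mu>\<in>UNIV. (e $ \<mu>)\<^sup>2) * Re (trace (two_copies 0 ** N))
        - (\<Sum>\<mu>\<in>UNIV. a \<mu> * e $ \<mu> * Re (trace (partial0 two_copies \<mu> ** N))) + Re (trace (Q ** N)))"
      unfolding sum_3 trace_two_copies_0 Re_trace_two_copies_derivative[OF psd_hermitian[OF N]] Q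
      by (simp add: a_def sum_2 algebra_simps)
    finally show "0 \<le> (\<Sum>\<mu>\<in>UNIV. (e $ \<mu>)\<^sup>2) * Re (trace (two_copies 0 ** N))
        - (\<Sum>\<mu>\<in>UNIV. a \<mu> * e $ \<mu> * Re (trace (partial0 two_copies \<mu> ** N))) + Re (trace (Q ** N))"
      by simp
  qed
  moreover have "trace (outer (excited a b)) = 2" "trace (outer (excited_flip a b)) = 2" for a b
    by (simp_all add: trace_outer excited_def excited_flip_def cinner_add_left cinner_axis) (simp_all add: axis_def)
  then have "Re (trace Q) = 5 / 16"
    by (simp add: Q_def sum_2 trace_add trace_scaleR)
  ultimately show ?thesis
    by (simp add: a_def sum_3)
qed

text \<open>The label \<open>l\<close> consists of the signs \<open>snd (l k)\<close> found on the two qubits \<open>t\<close> and two results \<open>fst (l k)\<close>.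
  If the signs agree, \<open>\<theta>\<^sub>2 \<plusminus> \<theta>\<^sub>3\<close> moves \<open>|00\<rangle>\<close> along \<open>|10\<rangle> + |01\<rangle>\<close>, and \<open>\<theta>\<^sub>1\<close> is ignored. If they differ, \<open>\<theta>\<^sub>1\<close> and \<open>\<theta>\<^sub>3\<close>
  move \<open>|00\<rangle>\<close> along \<open>- \<i> (|10\<rangle> + |01\<rangle>)\<close> and \<open>|10\<rangle> - |01\<rangle>\<close>; inner products between these three vectors are
  real, so an orthonormal basis with real coordinates serves both parameters at once.\<close>

definition chi :: "2 \<Rightarrow> 2 \<Rightarrow> real" where
  "chi s t = (if t = 1 then 1 else sg s)"

text \<open>In the basis of |00>, the normalized sum and difference of |10> and |01>, and |11>, the
  coordinates are 1, w, v, u v. Up to the phase in w, the four choices of signs form a Hadamard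
  matrix.\<close>

definition amplitude :: "bool \<Rightarrow> real \<Rightarrow> real \<Rightarrow> 2 \<Rightarrow> 2 \<Rightarrow> complex" where
  "amplitude same u v p q = (let w = (if same then of_real u else - \<i> * of_real u) in
    if p = 1 then if q = 1 then 1 else (w - of_real v) / of_real (sqrt 2)
    else if q = 1 then (w + of_real v) / of_real (sqrt 2) else of_real (u * v))"

definition two_copy_vec :: "(2 \<Rightarrow> 2 \<times> 2) \<Rightarrow> complex^(2 \<Rightarrow> 2 \<times> 2)" where
  "two_copy_vec l = (\<chi> i. of_real (chi (snd (l 1)) (snd (i 1)) * chi (snd (l 2)) (snd (i 2)) / 4) *
     amplitude (snd (l 1) = snd (l 2)) (sg (fst (l 1))) (sg (fst (l 2))) (fst (i 1)) (fst (i 2)))"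

text \<open>Each of the 16 outcomes has probability 1/16. theta_1 and theta_2 respond on 8 outcomes
  each and theta_3 on all, always with strength 1/4; hence the scales 1/2 and 1/4, and the squared
  estimate 5/16 at every outcome.\<close>

definition two_copy_est :: "(2 \<Rightarrow> 2 \<times> 2) \<Rightarrow> real^3" where
  "two_copy_est l = (let u = sg (fst (l 1)); v = sg (fst (l 2)); s = sg (snd (l 1)) in
     if snd (l 1) = snd (l 2) then vector [0, u / 2, s * u / 4] else vector [u / 2, 0, s * v / 4])"

lemma chi_orthogonal: "(\<Sum>t\<in>UNIV. chi s t * chi s' t) = (if s = s' then 2 else 0)"
proof -
  have "\<forall>s s'. (\<Sum>t\<in>UNIV. chi s t * chi s' t) = (if s = s' then 2 else 0)"
    unfolding forall_2 by (simp add: sum_2 chi_def sg_def)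
  then show ?thesis
    by blast
qed

text \<open>The phases cancel within one type \<open>b\<close>, and for signs u, v the sum is (1 + u
  u') (1 + v v').\<close>

lemma amplitude_orthogonal:
  "(\<Sum>p\<in>UNIV. \<Sum>q\<in>UNIV. cnj (amplitude b (sg u) (sg v) p q) * amplitude b (sg u') (sg v') p q)
    = (if u = u' \<and> v = v' then 4 else 0)"
proof -
  have "\<forall>u v u' v'. (\<Sum>p\<in>UNIV. \<Sum>q\<in>UNIV. cnj (amplitude b (sg u) (sg v) p q) * amplitude b (sg u') (sg v') p q)
      = (if u = u' \<and> v = v' then 4 else 0)"
    unfolding forall_2 by (cases b) (simp_all add: sum_2 amplitude_def sg_def complex_eq_iff field_simps)
  then show ?thesis
    by blast
qed

text \<open>The inner product factors over the qubits \<open>t\<close> and the pair of qubits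
  \<open>r\<close>. Different sign patterns are separated by \<open>chi\<close>; equal ones use the
  same type of amplitudes.\<close>

lemma two_copy_vec_orthonormal: "cinner (two_copy_vec l) (two_copy_vec l') = (if l = l' then 1 else 0)"
proof -
  define b b' u v u' v' where "b = (snd (l 1) = snd (l 2))" and "b' = (snd (l' 1) = snd (l' 2))"
    and "u = fst (l 1)" and "v = fst (l 2)" and "u' = fst (l' 1)" and "v' = fst (l' 2)"
  let ?c1 = "\<Sum>t\<in>UNIV. chi (snd (l 1)) t * chi (snd (l' 1)) t"
  let ?c2 = "\<Sum>t\<in>UNIV. chi (snd (l 2)) t * chi (snd (l' 2)) t"
  let ?r = "\<lambda>p q. cnj (amplitude b (sg u) (sg v) p q) * amplitude b' (sg u') (sg v') p q"
  have pair: "(\<Sum>x\<in>UNIV. g x) = (\<Sum>p\<in>UNIV. \<Sum>t\<in>UNIV. g (p, t))" for g :: "2 \<times> 2 \<Rightarrow> complex"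
    by (simp add: sum.cartesian_product)
  have factor: "(\<Sum>p\<in>UNIV. \<Sum>t\<in>UNIV. \<Sum>q\<in>UNIV. \<Sum>t'\<in>UNIV. f t * g t' / 16 * r p q)
      = (\<Sum>t\<in>UNIV. f t) * (\<Sum>t\<in>UNIV. g t) / 16 * (\<Sum>p\<in>UNIV. \<Sum>q\<in>UNIV. r p q)"
    for f g :: "2 \<Rightarrow> complex" and r :: "2 \<Rightarrow> 2 \<Rightarrow> complex"
    by (simp add: sum_2 algebra_simps add_divide_distrib)
  have "cinner (two_copy_vec l) (two_copy_vec l') = (\<Sum>p\<in>UNIV. \<Sum>t\<in>UNIV. \<Sum>q\<in>UNIV. \<Sum>t'\<in>UNIV.
      of_real (chi (snd (l 1)) t * chi (snd (l' 1)) t) * of_real (chi (snd (l 2)) t' * chi (snd (l' 2)) t') / 16 * ?r p q)"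
    unfolding cinner_def sum_fun_2 pair
    by (simp add: two_copy_vec_def b_def b'_def u_def v_def u'_def v'_def mult_ac)
  also have "\<dots> = of_real ?c1 * of_real ?c2 / 16 * (\<Sum>p\<in>UNIV. \<Sum>q\<in>UNIV. ?r p q)"
    unfolding of_real_sum by (rule factor)
  also have "\<dots> = (if l = l' then 1 else 0)"
  proof (cases "snd (l 1) = snd (l' 1) \<and> snd (l 2) = snd (l' 2)")
    case True
    then have "b = b'"
      by (simp add: b_def b'_def)
    moreover have "l = l' \<longleftrightarrow> u = u' \<and> v = v'"
      using True by (auto simp: fun_2_eq_iff u_def v_def u'_def v'_def prod_eq_iff)
    ultimately show ?thesis
      using True by (simp add: chi_orthogonal amplitude_orthogonal)
  next
    case False
    then have "l \<noteq> l'"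
      by auto
    with False show ?thesis
      unfolding chi_orthogonal by auto
  qed
  finally show ?thesis .
qed

text \<open>There are as many vectors as dimensions, so the matrix with these columns is square and
  its left inverse is also a right inverse.\<close>

lemma sum_outer_orthonormal:
  fixes f :: "'h::finite \<Rightarrow> complex^'h"
  assumes "\<And>l l'. cinner (f l) (f l') = (if l = l' then 1 else 0)"
  shows "(\<Sum>l\<in>UNIV. outer (f l)) = mat 1"
proof -
  define V :: "'h operator" where "V = (\<chi> i l. f l $ i)"
  have "dagger V ** V = mat 1"
    using assms by (simp add: vec_eq_iff V_def matrix_mult_nth cinner_def mat_def)
  then have "V ** dagger V = mat 1"
    using matrix_left_right_inverse by blast
  moreover have "V ** dagger V = (\<Sum>l\<in>UNIV. outer (f l))"
    by (simp add: vec_eq_iff V_def matrix_mult_nth outer_nth)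
  ultimately show ?thesis
    by simp
qed

lemma two_copy_vec_projective:
  "outer (two_copy_vec l) ** outer (two_copy_vec l') = (if l = l' then outer (two_copy_vec l) else 0)"
  by (simp add: outer_mult_outer two_copy_vec_orthonormal vec_eq_iff outer_nth)

lemma two_copy_traces:
  "Re (trace (two_copies 0 ** outer (two_copy_vec l))) = 1 / 16"
  "Re (trace (partial0 two_copies 1 ** outer (two_copy_vec l)))
    = (if snd (l 1) = snd (l 2) then 0 else sg (fst (l 1)) / 4)"
  "Re (trace (partial0 two_copies 2 ** outer (two_copy_vec l)))
    = (if snd (l 1) = snd (l 2) then sg (fst (l 1)) / 4 else 0)"
  "Re (trace (partial0 two_copies 3 ** outer (two_copy_vec l)))
    = sg (snd (l 1)) * (if snd (l 1) = snd (l 2) then sg (fst (l 1)) else sg (fst (l 2))) / 4"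
  unfolding trace_two_copies_0 Re_trace_two_copies_derivative[OF psd_hermitian[OF psd_outer]]
    matrix_vector_mult_excited sum_2
  by (auto simp: outer_nth two_copy_vec_def chi_def amplitude_def sg_def) (metis exhaust_2)

lemma two_copy_estimator:
  obtains K M est where "projective_measurement K M" "locally_unbiased two_copies K M est"
    "trace (mat 1 ** mse_matrix (two_copies 0) K M est) = 5 / 16"
proof -
  have unbiased_0: "\<forall>\<mu>. (\<Sum>l\<in>UNIV. Re (trace (two_copies 0 ** outer (two_copy_vec l))) * two_copy_est l $ \<mu>) = 0"
    unfolding forall_3 two_copy_traces
    by (simp add: sum_fun_2 sum_qubit_pair two_copy_est_def sg_def)
  have unbiased_D: "\<forall>\<mu> \<nu>. (\<Sum>l\<in>UNIV. Re (trace (partial0 two_copies \<nu> ** outer (two_copy_vec l))) * two_copy_est l $ \<mu>)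
      = (if \<mu> = \<nu> then 1 else 0)"
    unfolding forall_3 two_copy_traces
    by (simp add: sum_fun_2 sum_qubit_pair two_copy_est_def sg_def)
  have herm: "hermitian (two_copies 0)" "hermitian (partial0 two_copies \<mu>)" for \<mu>
    by (simp_all add: qubit_model_0 hermitian_tensor_power hermitian_qubit_rho0)
      (simp add: partial0_two_copies hermitian_def vec_eq_iff
        flip: hermitian_nth[OF hermitian_tangent] hermitian_nth[OF hermitian_qubit_rho0])
  have mse: "(\<Sum>l\<in>UNIV. Re (trace (two_copies 0 ** outer (two_copy_vec l))) * (\<Sum>\<mu>\<in>UNIV. (two_copy_est l $ \<mu>)\<^sup>2)) = 5 / 16"
    unfolding two_copy_traces sum_3
    by (simp add: sum_fun_2 sum_qubit_pair two_copy_est_def sg_def power_divide)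
  show ?thesis
    by (rule labelled_estimator[OF psd_outer sum_outer_orthonormal[OF two_copy_vec_orthonormal] herm
          unbiased_0[rule_format] unbiased_D[rule_format]])
      (use that mse two_copy_vec_projective in simp)
qed

lemma finite_copy_optimum_2: "finite_copy_optimum TYPE(2) qubit_model (mat 1) = ereal (5 / 8)"
proof -
  obtain K M est where "locally_unbiased two_copies K M est"
    "trace (mat 1 ** mse_matrix (two_copies 0) K M est) = 5 / 16"
    by (rule two_copy_estimator)
  from finite_copy_optimum_eqI[OF two_copy_mse_ge this] show ?thesis
    by simp
qed

theorem mainTheorem1:
  shows "smooth_state_family qubit_model
    \<and> (\<forall>\<theta>. rank (qubit_model \<theta>) = 2)
    \<and> locally_identifiable qubit_model
    \<and> finite_copy_optimum TYPE(1) qubit_model (mat 1) = ereal ((3 + 2 * sqrt 2) / 8)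
    \<and> finite_copy_optimum TYPE(1) qubit_model (mat 1) > holevo_bound qubit_model (mat 1)
    \<and> holevo_bound qubit_model (mat 1) = finite_copy_optimum TYPE(2) qubit_model (mat 1)
    \<and> finite_copy_optimum TYPE(2) qubit_model (mat 1) = ereal (5 / 8)
    \<and> (\<exists>X. holevo_feasible qubit_model X \<and> holevo_value qubit_model (mat 1) X = 5 / 8)
    \<and> (\<exists>K (M :: nat \<Rightarrow> (2 \<Rightarrow> 2 \<times> 2) operator) est.
          projective_measurement K M
          \<and> locally_unbiased (\<lambda>\<theta>. tensor_power (qubit_model \<theta>)) K M est
          \<and> 2 * trace (mat 1 ** mse_matrix (tensor_power (qubit_model 0)) K M est) = 5 / 8)
    \<and> \<not> (\<forall>(\<rho> :: real^3 \<Rightarrow> (2 \<times> 2) operator) W.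
          smooth_state_family \<rho> \<longrightarrow> locally_identifiable \<rho> \<longrightarrow> pos_def W \<longrightarrow>
          finite_copy_optimum TYPE(1) \<rho> W > holevo_bound \<rho> W \<longrightarrow>
          finite_copy_optimum TYPE(2) \<rho> W > holevo_bound \<rho> W)"
proof -
  have smooth: "smooth_state_family qubit_model"
    by (simp add: smooth_state_family_def smooth_qubit_model density_operator_qubit_model)
  have gap: "finite_copy_optimum TYPE(1) qubit_model (mat 1) > holevo_bound qubit_model (mat 1)"
    by (simp add: finite_copy_optimum_1 holevo_bound_qubit_model)
  have eq: "holevo_bound qubit_model (mat 1) = finite_copy_optimum TYPE(2) qubit_model (mat 1)"
    by (simp add: finite_copy_optimum_2 holevo_bound_qubit_model)
  have "pos_def (mat 1 :: real^3^3)"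
    by (simp add: pos_def_def transpose_mat)
  then have "\<not> (\<forall>(\<rho> :: real^3 \<Rightarrow> (2 \<times> 2) operator) W.
      smooth_state_family \<rho> \<longrightarrow> locally_identifiable \<rho> \<longrightarrow> pos_def W \<longrightarrow>
      finite_copy_optimum TYPE(1) \<rho> W > holevo_bound \<rho> W \<longrightarrow>
      finite_copy_optimum TYPE(2) \<rho> W > holevo_bound \<rho> W)"
    using smooth locally_identifiable_qubit_model gap eq by (metis less_irrefl)
  moreover have "\<exists>K (M :: nat \<Rightarrow> (2 \<Rightarrow> 2 \<times> 2) operator) est. projective_measurement K M
      \<and> locally_unbiased two_copies K M est \<and> 2 * trace (mat 1 ** mse_matrix (two_copies 0) K M est) = 5 / 8"
    by (rule two_copy_estimator) (force)
  ultimately show ?thesis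
    using smooth rank_qubit_model locally_identifiable_qubit_model finite_copy_optimum_1 gap eq finite_copy_optimum_2
      holevo_feasible_holevo_point holevo_value_holevo_point by blast
qed

end
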